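(* Let $$V_1=\mathbb{R}_+^*\cdot\pi_{SO(2)}^{-1}(U)=\left\{(q,q')\in\mathbb{O}^*\times\mathbb{O}^*:\ |q|=|q'|,\ B(q,q')=0,\ 0<|\operatorname{Im}(x\,\overline{x'})|<\tfrac12|q|^2\right\},$$ where $q=(x,y)$, $q'=(x',y')$. Consider the action of $(\mathbb{R}_+^* )^2$ on $V_1$ defined by $$(\alpha,\beta)\cdot(q,q')=\big((\alpha x,\beta y),(\beta x',\alpha y')\big).$$ Then the action of $(\mathbb{R}_+^* )^2$ commutes with that of $G^0$. Let $(q_0,q_0')\in V_1$, $q_0=(x_0,y_0)$, $q_0'=(x_0',y_0')$, be such that $\langle x_0,x_0'\rangle=0$. Then for every $(q,q')\in V_1$ there exist $(g,(\alpha,\beta))\in G^0\times(\mathbb{R}_+^* )^2$ and $\theta\in\mathbb{R}$ such that $$\big(g\cdot(\alpha,\beta)\cdot(q_0,q_0')\big)\cdot R_\theta=(q,q').$$ There are exactly two possibilities for $(\alpha,\beta)$, one with $\alpha<|q|/(\sqrt2|x_0|)$, the other with $\alpha>|q|/(\sqrt2|x_0|)$. $R_\theta$ can be changed into $-R_\theta$ (and hence $g$ into $-g$), and $g$ can vary in $g\cdot\mathrm{Stab}([q_0,q_0'])$.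
   Context: $\mathbb{H}$ denotes the quaternions, $S^3$ the unit quaternions, $\mathbb{O}=\mathbb{H}^2=\mathbb{R}^8$ with its Euclidean structure, $S^7$ its unit sphere, $\mathbb{O}^*=\mathbb{O}\smallsetminus\{0\}$. For $q=(x,y)$, $q'=(x',y')$, $B(q,q')=x\overline{x'}+y'\overline{y}\in\mathbb{H}$, and $V=\{(q,q')\in S^7\times S^7: B(q,q')=0\}$. For $\theta\in\mathbb{R}$, $(q,q')\cdot R_\theta=(\cos\theta\,q+\sin\theta\,q',\,-\sin\theta\,q+\cos\theta\,q')$; this defines an action of $SO(2)$ on $V$, with quotient $Q=V/SO(2)$, the set of oriented planes spanned by the pairs in $V$, and $\pi_{SO(2)}\colon V\to Q$ is the projection. $[q,q']$ is the oriented plane spanned by $(q,q')$. $U$ is the open set of planes $[(x,y),(x',y')]\in Q$ (with $((x,y),(x',y'))\in V$) such that $(x,x')$ is linearly independent over $\mathbb{R}$ and $|\langle x,x'\rangle|+\big||x|-|x'|\big|\neq0$. $\mathbb{R}_+^*$ acts on pairs by simultaneous scaling. $G=\{g\in SO(8): \forall q,q',\ B(q,q')=0\Leftrightarrow B(gq,gq')=0\}$ acts on pairs by $g\cdot(q,q')=(gq,gq')$ and on $Q$ by $g\cdot[q,q']=[gq,gq']$; its identity component $G^0$ is the group of maps $(x,y)\mapsto(cxa,cyb)$ of $\mathbb{O}$, $a,b,c\in S^3$. $\mathrm{Stab}([q_0,q_0'])$ is the stabilizer of $[q_0,q_0']$ for the action of $G$.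
   Formalization: The formula for (α,β) does not map V₁ into itself (if ⟨x,x'⟩=0 and α|x|=β|x'|, the image violates |Im(x x̄')|<½|q|²), so the action of (ℝ₊* )² is taken on all pairs in 𝕆×𝕆 instead of on V₁; everything else is as stated. *)

theory Defs
  imports "HOL-Analysis.Analysis"
begin

text \<open>
  A quaternion is a pair (real part, imaginary part), the imaginary part being a vector of
  Euclidean 3-space. The inner products and norms on quaternions, on pairs of
  quaternions, and on pairs of those, are the library ones on products, that is, the
  Euclidean ones.
\<close>

type_synonym quat = "real \<times> (real ^ 3)"
type_synonym oct = "quat \<times> quat"
type_synonym opair = "oct \<times> oct"

definition qmult :: "quat \<Rightarrow> quat \<Rightarrow> quat"  (infixl "\<odot>" 70) where
  "p \<odot> q = (fst p * fst q - snd p \<bullet> snd q,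
            fst p *\<^sub>R snd q + fst q *\<^sub>R snd p + cross3 (snd p) (snd q))"

definition qcnj :: "quat \<Rightarrow> quat" where
  "qcnj p = (fst p, - snd p)"

definition qIm :: "quat \<Rightarrow> real ^ 3" where
  "qIm p = snd p"

definition Bform :: "oct \<Rightarrow> oct \<Rightarrow> quat" where
  "Bform = (\<lambda>(x, y) (x', y'). x \<odot> qcnj x' + y' \<odot> qcnj y)"

definition Vpairs :: "opair set" where
  "Vpairs = {(q, q'). q \<in> sphere 0 1 \<and> q' \<in> sphere 0 1 \<and> Bform q q' = 0}"

definition rot :: "real \<Rightarrow> opair \<Rightarrow> opair" where
  "rot \<theta> = (\<lambda>(q, q'). (cos \<theta> *\<^sub>R q + sin \<theta> *\<^sub>R q', (- sin \<theta>) *\<^sub>R q + cos \<theta> *\<^sub>R q'))"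

text \<open>
  The oriented plane spanned by a linearly independent pair (not necessarily orthonormal) is
  encoded as the set of all positively oriented bases of that plane. On \<open>Vpairs\<close> the
  fibres of this map are exactly the orbits of the rotations (\<open>oplane_eq_iff_rot\<close> below), so
  that \<open>piSO2\<close> is the projection onto the quotient by \<open>SO(2)\<close>.
\<close>

definition oplane :: "opair \<Rightarrow> opair set" where
  "oplane = (\<lambda>(q, q'). {(a *\<^sub>R q + b *\<^sub>R q', c *\<^sub>R q + d *\<^sub>R q') | a b c d. a * d - b * c > 0})"

definition Qplanes :: "opair set set" where
  "Qplanes = oplane ` Vpairs"

definition piSO2 :: "opair \<Rightarrow> opair set" where
  "piSO2 = restrict oplane Vpairs"

definition Uplanes :: "opair set set" where
  "Uplanes = {P \<in> Qplanes. \<exists>x y x' y'.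
     P = oplane ((x, y), (x', y')) \<and> ((x, y), (x', y')) \<in> Vpairs \<and>
     x \<noteq> x' \<and> independent {x, x'} \<and>
     \<bar>x \<bullet> x'\<bar> + \<bar>norm x - norm x'\<bar> \<noteq> 0}"

definition V1 :: "opair set" where
  "V1 = {r *\<^sub>R p | r p. r > 0 \<and> p \<in> Vpairs \<and> piSO2 p \<in> Uplanes}"

definition of_R8 :: "real ^ 8 \<Rightarrow> oct" where
  "of_R8 v = ((v $ 1, vector [v $ 2, v $ 3, v $ 4]), (v $ 5, vector [v $ 6, v $ 7, v $ 8]))"

definition to_R8 :: "oct \<Rightarrow> real ^ 8" where
  "to_R8 = (\<lambda>((s, u), (t, v)). vector [s, u $ 1, u $ 2, u $ 3, t, v $ 1, v $ 2, v $ 3])"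

definition SO8 :: "(oct \<Rightarrow> oct) set" where
  "SO8 = {g. orthogonal_transformation g \<and> det (matrix (to_R8 \<circ> g \<circ> of_R8)) = 1}"

definition Ggrp :: "(oct \<Rightarrow> oct) set" where
  "Ggrp = {g \<in> SO8. \<forall>q q'. Bform q q' = 0 \<longleftrightarrow> Bform (g q) (g q') = 0}"

text \<open>
  The identity component. The function space carries the topology of pointwise convergence,
  which on linear maps between finite-dimensional spaces is the usual topology, so this is the
  identity component of \<open>Ggrp\<close> as a Lie group: the maps sending \<open>(x, y)\<close> to
  \<open>(c x a, c y b)\<close> with unit quaternions \<open>a\<close>, \<open>b\<close>, \<open>c\<close>.
\<close>

definition G0grp :: "(oct \<Rightarrow> oct) set" where
  "G0grp = connected_component_set Ggrp id"

definition act :: "(oct \<Rightarrow> oct) \<Rightarrow> opair \<Rightarrow> opair" where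
  "act g = (\<lambda>(q, q'). (g q, g q'))"

definition act_plane :: "(oct \<Rightarrow> oct) \<Rightarrow> opair set \<Rightarrow> opair set" where
  "act_plane g P = act g ` P"

definition Stab :: "opair set \<Rightarrow> (oct \<Rightarrow> oct) set" where
  "Stab P = {g \<in> Ggrp. act_plane g P = P}"

text \<open>
  The formula for the action of pairs of positive reals is used on all pairs, since it does not
  map \<open>V1\<close> into itself: \<open>((1, y), (2i, y'))\<close> in \<open>V1\<close> and the scalars \<open>2, 1\<close> give a pair whose
  first components \<open>2, 2i\<close> are orthogonal of equal norm.
\<close>

definition dil :: "real \<Rightarrow> real \<Rightarrow> opair \<Rightarrow> opair" where
  "dil \<alpha> \<beta> = (\<lambda>((x, y), (x', y')). ((\<alpha> *\<^sub>R x, \<beta> *\<^sub>R y), (\<beta> *\<^sub>R x', \<alpha> *\<^sub>R y')))"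

lemma qmult_assoc: "(p \<odot> q) \<odot> r = p \<odot> (q \<odot> r)"
proof -
  have "fst ((p \<odot> q) \<odot> r) = fst (p \<odot> (q \<odot> r))"
    by (simp add: qmult_def cross3_simps)
  moreover have "snd ((p \<odot> q) \<odot> r) $ i = snd (p \<odot> (q \<odot> r)) $ i" for i
    using exhaust_3[of i] by (auto simp: qmult_def cross3_simps)
  ultimately show ?thesis
    by (simp add: prod_eq_iff vec_eq_iff)
qed

lemma qmult_qcnj: "p \<odot> qcnj p = ((norm p)\<^sup>2, 0)"
proof -
  have "cross3 u (- u) = 0" for u :: "real ^ 3"
    by (simp add: cross_minus_right)
  then show ?thesis
    by (simp add: qmult_def qcnj_def power2_norm_eq_inner inner_prod_def)
qed

lemma vector_8:
  fixes w\<^sub>1 w\<^sub>2 w\<^sub>3 w\<^sub>4 w\<^sub>5 w\<^sub>6 w\<^sub>7 w\<^sub>8 :: real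
  defines "w \<equiv> (vector [w\<^sub>1, w\<^sub>2, w\<^sub>3, w\<^sub>4, w\<^sub>5, w\<^sub>6, w\<^sub>7, w\<^sub>8] :: real ^ 8)"
  shows "w $ 1 = w\<^sub>1" "w $ 2 = w\<^sub>2" "w $ 3 = w\<^sub>3" "w $ 4 = w\<^sub>4"
    "w $ 5 = w\<^sub>5" "w $ 6 = w\<^sub>6" "w $ 7 = w\<^sub>7" "w $ 8 = w\<^sub>8"
  by (simp_all add: vector_def w_def)

lemma exhaust_8:
  fixes i :: 8
  shows "i = 1 \<or> i = 2 \<or> i = 3 \<or> i = 4 \<or> i = 5 \<or> i = 6 \<or> i = 7 \<or> i = 8"
proof (induct i)
  case (of_int z)
  then have "z = 0 \<or> z = 1 \<or> z = 2 \<or> z = 3 \<or> z = 4 \<or> z = 5 \<or> z = 6 \<or> z = 7"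
    by (simp, arith)
  then show ?case by auto
qed

lemma UNIV_8: "(UNIV :: 8 set) = {1, 2, 3, 4, 5, 6, 7, 8}"
  using exhaust_8 by auto

lemma of_R8_to_R8 [simp]: "of_R8 (to_R8 q) = q"
proof -
  have "u = v" if "u $ 1 = v $ 1" "u $ 2 = v $ 2" "u $ 3 = v $ 3" for u v :: "real ^ 3"
    using that by (simp add: vec_eq_iff forall_3)
  then show ?thesis
    by (auto simp: of_R8_def to_R8_def vector_8 vector_3 split: prod.splits)
qed

lemma to_R8_of_R8 [simp]: "to_R8 (of_R8 v) = v"
proof -
  have "to_R8 (of_R8 v) $ i = v $ i" for i
    using exhaust_8[of i] by (auto simp: of_R8_def to_R8_def vector_8 vector_3)
  then show ?thesis by (simp add: vec_eq_iff)
qed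

lemma inner_of_R8: "of_R8 v \<bullet> of_R8 w = v \<bullet> w"
  unfolding inner_vec_def[of v w] UNIV_8
  by (simp add: of_R8_def inner_prod_def inner_vec_def sum_3 vector_3)

lemma linear_of_R8: "linear of_R8"
proof -
  have "u = v" if "u $ 1 = v $ 1" "u $ 2 = v $ 2" "u $ 3 = v $ 3" for u v :: "real ^ 3"
    using that by (simp add: vec_eq_iff forall_3)
  then show ?thesis
    by (intro linearI) (auto simp: of_R8_def vector_3)
qed

lemma dil_one: "dil 1 1 p = p"
  by (cases p) (auto simp: dil_def)

lemma dil_dil: "dil \<alpha> \<beta> (dil \<alpha>' \<beta>' p) = dil (\<alpha> * \<alpha>') (\<beta> * \<beta>') p"
  by (auto simp: dil_def split: prod.splits)

lemma act_plane_oplane: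
  assumes "linear g"
  shows "act_plane g (oplane p) = oplane (act g p)"
proof (cases p rule: prod.exhaust)
  case (Pair q q')
  have *: "g (a *\<^sub>R u + b *\<^sub>R v) = a *\<^sub>R g u + b *\<^sub>R g v" for a b u v
    using assms by (simp add: linear_add linear_cmul)
  show ?thesis
    unfolding Pair act_plane_def act_def oplane_def prod.case
  proof (intro equalityI subsetI)
    fix P
    assume "P \<in> (\<lambda>(q, q'). (g q, g q')) `
      {(a *\<^sub>R q + b *\<^sub>R q', c *\<^sub>R q + d *\<^sub>R q') | a b c d. a * d - b * c > 0}"
    then obtain a b c d where "a * d - b * c > 0"
      and "P = (a *\<^sub>R g q + b *\<^sub>R g q', c *\<^sub>R g q + d *\<^sub>R g q')"
      by (auto simp: * simp del: scaleR_Pair)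
    then show "P \<in> {(a *\<^sub>R g q + b *\<^sub>R g q', c *\<^sub>R g q + d *\<^sub>R g q') | a b c d. a * d - b * c > 0}"
      by blast
  next
    fix P
    assume "P \<in> {(a *\<^sub>R g q + b *\<^sub>R g q', c *\<^sub>R g q + d *\<^sub>R g q') | a b c d. a * d - b * c > 0}"
    then obtain a b c d where "a * d - b * c > 0"
      and "P = (g (a *\<^sub>R q + b *\<^sub>R q'), g (c *\<^sub>R q + d *\<^sub>R q'))"
      by (auto simp: *)
    then show "P \<in> (\<lambda>(q, q'). (g q, g q')) `
      {(a *\<^sub>R q + b *\<^sub>R q', c *\<^sub>R q + d *\<^sub>R q') | a b c d. a * d - b * c > 0}"
      by (intro image_eqI[of _ _ "(a *\<^sub>R q + b *\<^sub>R q', c *\<^sub>R q + d *\<^sub>R q')"], simp, blast)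
  qed
qed

lemma oplane_comb_subset:
  assumes "a * d - b * c > 0"
  shows "oplane (a *\<^sub>R q + b *\<^sub>R q', c *\<^sub>R q + d *\<^sub>R q') \<subseteq> oplane (q, q')"
proof
  fix P
  assume "P \<in> oplane (a *\<^sub>R q + b *\<^sub>R q', c *\<^sub>R q + d *\<^sub>R q')"
  then obtain a' b' c' d' where pos: "a' * d' - b' * c' > 0"
    and P: "P = (a' *\<^sub>R (a *\<^sub>R q + b *\<^sub>R q') + b' *\<^sub>R (c *\<^sub>R q + d *\<^sub>R q'),
                 c' *\<^sub>R (a *\<^sub>R q + b *\<^sub>R q') + d' *\<^sub>R (c *\<^sub>R q + d *\<^sub>R q'))"
    by (auto simp: oplane_def)
  have "(a' * a + b' * c) * (c' * b + d' * d) - (a' * b + b' * d) * (c' * a + d' * c)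
      = (a' * d' - b' * c') * (a * d - b * c)"
    by algebra
  with assms pos have "(a' * a + b' * c) * (c' * b + d' * d) - (a' * b + b' * d) * (c' * a + d' * c) > 0"
    by simp
  moreover have "P = ((a' * a + b' * c) *\<^sub>R q + (a' * b + b' * d) *\<^sub>R q',
                      (c' * a + d' * c) *\<^sub>R q + (c' * b + d' * d) *\<^sub>R q')"
    by (simp add: P scaleR_add_left scaleR_add_right)
  ultimately show "P \<in> oplane (q, q')"
    unfolding oplane_def prod.case by blast
qed

lemma rot_rot: "rot \<theta> (rot \<phi> p) = rot (\<theta> + \<phi>) p"
  by (cases p) (simp add: rot_def cos_add sin_add algebra_simps)

lemma oplane_rot: "oplane (rot \<theta> p) = oplane p"
proof -
  have sub: "oplane (rot \<theta> p) \<subseteq> oplane p" for \<theta> p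
  proof (cases p rule: prod.exhaust)
    case (Pair q q')
    have "cos \<theta> * cos \<theta> - sin \<theta> * (- sin \<theta>) > 0"
      using sin_cos_squared_add[of \<theta>] by (simp add: power2_eq_square)
    from oplane_comb_subset[OF this, of q q'] show ?thesis
      by (simp add: Pair rot_def)
  qed
  have "rot (- \<theta>) (rot \<theta> p) = p"
    unfolding rot_rot by (cases p) (simp add: rot_def)
  with sub[of \<theta> p] sub[of "- \<theta>" "rot \<theta> p"] show ?thesis by auto
qed

lemma Vpairs_orthonormal:
  assumes "(q, q') \<in> Vpairs"
  shows "q \<bullet> q = 1" "q' \<bullet> q' = 1" "q \<bullet> q' = 0"
proof -
  show "q \<bullet> q = 1" "q' \<bullet> q' = 1"
    using assms by (simp_all add: Vpairs_def norm_eq_1)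
  have "fst (Bform q q') = 0"
    using assms by (simp add: Vpairs_def)
  then show "q \<bullet> q' = 0"
    by (cases q; cases q') (simp add: Bform_def qmult_def qcnj_def inner_prod_def
        inner_commute mult.commute)
qed

lemma oplane_eq_iff_rot:
  assumes p: "p \<in> Vpairs" and p': "p' \<in> Vpairs"
  shows "oplane p = oplane p' \<longleftrightarrow> (\<exists>\<theta>. p' = rot \<theta> p)"
proof
  assume "\<exists>\<theta>. p' = rot \<theta> p"
  then show "oplane p = oplane p'"
    using oplane_rot by metis
next
  assume eq: "oplane p = oplane p'"
  obtain q q' where pq: "p = (q, q')" by (cases p)
  obtain r r' where pr: "p' = (r, r')" by (cases p')
  have "(r, r') = (1 *\<^sub>R r + 0 *\<^sub>R r', 0 *\<^sub>R r + 1 *\<^sub>R r')" "(1::real) * 1 - 0 * 0 > 0"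
    by simp_all
  then have "p' \<in> oplane p'"
    unfolding pr oplane_def prod.case by blast
  then have "p' \<in> oplane p"
    using eq by simp
  then obtain a b c d where pos: "a * d - b * c > 0"
    and r: "r = a *\<^sub>R q + b *\<^sub>R q'" and r': "r' = c *\<^sub>R q + d *\<^sub>R q'"
    by (auto simp: pq pr oplane_def)
  note o = Vpairs_orthonormal[OF p[unfolded pq]] and o' = Vpairs_orthonormal[OF p'[unfolded pr]]
  have o3: "q' \<bullet> q = 0" using o(3) by (simp add: inner_commute)
  have 1: "a\<^sup>2 + b\<^sup>2 = 1" and 2: "c\<^sup>2 + d\<^sup>2 = 1" and 3: "a * c + b * d = 0"
    using o' o o3 by (simp_all add: r r' inner_add_left inner_add_right power2_eq_square
        mult.commute)
  have "(a * d - b * c)\<^sup>2 = 1"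
    using 1 2 3 by algebra
  with pos have det: "a * d - b * c = 1"
    by (simp add: power2_eq_1_iff)
  have "d = a" "c = - b"
    using 1 2 3 det by algebra+
  moreover obtain \<theta> where "a = cos \<theta>" "b = sin \<theta>"
    using 1 sincos_total_2pi by metis
  ultimately show "\<exists>\<theta>. p' = rot \<theta> p"
    by (auto simp: pq pr r r' rot_def)
qed

end

theory Submission
  imports Defs
begin

text \<open>
  Let \<open>K\<close> (below \<open>Kgrp\<close>) be the group of maps \<open>(x, y) \<mapsto> (c x a, c y b)\<close> with unit quaternions
  \<open>a, b, c\<close>. Everything rests on \<open>K\<close> being the identity component \<open>G0grp\<close>
  (\<open>G0grp_eq_Kgrp\<close>): these maps visibly commute with the dilations \<open>dil \<alpha> \<beta>\<close>. To see it, note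
  that the components of the form are \<open>q \<bullet> J\<^sub>u q'\<close> with
  \<open>J\<^sub>u (x, y) = (u x, qcnj u y)\<close>. An element \<open>g\<close> of \<open>Ggrp\<close> therefore maps the
  space of all \<open>J\<^sub>u q\<close> to that of all \<open>J\<^sub>u (g q)\<close>, and this forces \<open>J\<^sub>u g = g J\<^sub>v\<close> with \<open>v\<close>
  depending linearly on \<open>u\<close> (\<open>intertwiner_exists\<close>). The map \<open>u \<mapsto> v\<close> is an isometry that is either multiplicative or
  antimultiplicative. As automorphisms of the quaternions are inner, \<open>g\<close> lies in \<open>K\<close> in the first
  case, and in the second case in \<open>K\<close> up to exchanging \<open>x\<close> and \<open>y\<close> (\<open>Ggrp_cases\<close>). The two
  cosets are separated by a continuous function, so \<open>K\<close> is the identity component.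

  A pair of equal norms with vanishing form satisfies \<open>\<bar>x\<bar>\<^sup>2 + \<bar>x'\<bar>\<^sup>2 = \<bar>q\<bar>\<^sup>2\<close>, \<open>\<bar>y\<bar> = \<bar>x'\<bar>\<close>,
  \<open>\<bar>y'\<bar> = \<bar>x\<bar>\<close>, and rotations preserve \<open>m = \<bar>Im (x (qcnj x'))\<bar>\<close>. As \<open>m\<^sup>2 = \<bar>x\<bar>\<^sup>2 \<bar>x'\<bar>\<^sup>2 - (x \<bullet> x')\<^sup>2\<close>,
  linear independence of \<open>x\<close> and \<open>x'\<close> means \<open>m > 0\<close>, and the identity
  \<open>\<bar>q\<bar>\<^sup>4/4 - m\<^sup>2 = (\<bar>x\<bar>\<^sup>2 - \<bar>x'\<bar>\<^sup>2)\<^sup>2/4 + (x \<bullet> x')\<^sup>2\<close> turns the conditions defining the open set of planes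
  into \<open>0 < m < \<bar>q\<bar>\<^sup>2/2\<close>, which is the description of \<open>V1\<close> (\<open>V1_eq_Vcone\<close>).

  A rotation makes \<open>x\<close> and \<open>x'\<close> orthogonal. Their norms then have product \<open>m\<close> and sum of squares
  \<open>\<bar>q\<bar>\<^sup>2\<close>, so they are determined up to order, and they are distinct as \<open>2 m < \<bar>q\<bar>\<^sup>2\<close>. Since \<open>K\<close> acts
  transitively on pairs in this normal form with prescribed norms (\<open>kmap_transitive\<close>), a dilation
  \<open>(\<alpha>, \<beta>)\<close> of the base pair reaches the given pair exactly when \<open>\<alpha> \<bar>x\<^sub>0\<bar>\<close>, \<open>\<beta> \<bar>x\<^sub>0'\<bar>\<close> are these two
  norms in one of the two orders (\<open>reachable_dilations\<close>). Finally, because the norms of the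
  first components differ, a symmetry that maps the plane of the dilated pair to itself acts on
  it as \<open>\<plusminus>1\<close> or as a quarter turn, and such a relation is insensitive to the dilation
  (\<open>stabilizer_commutes_dil\<close>); this gives the ambiguity of \<open>g\<close> and of the rotation
  (\<open>solutions_of_fixed_dilation\<close>).
\<close>

section \<open>Quaternion algebra\<close>

definition qone :: quat where "qone = (1, 0)"

lemma quat_eqI:
  assumes "fst p = fst q" "snd p $ 1 = snd q $ 1" "snd p $ 2 = snd q $ 2" "snd p $ 3 = snd q $ 3"
  shows "p = (q :: quat)"
  using assms by (simp add: prod_eq_iff vec_eq_iff forall_3)

lemma bilinear_qmult: "bilinear qmult"
  unfolding bilinear_def qmult_def
  by (auto intro!: linearI quat_eqI simp: cross3_simps)

interpretation qmult: bounded_bilinear qmult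
  using bilinear_qmult by (simp add: bilinear_conv_bounded_bilinear)

declare qmult.zero_left [simp] qmult.zero_right [simp]
declare split_paired_All [simp del] split_paired_Ex [simp del]

lemma qone_mult [simp]: "qone \<odot> p = p" "p \<odot> qone = p"
  by (auto intro!: quat_eqI simp: qone_def qmult_def cross3_simps)

lemma norm_qone [simp]: "norm qone = 1"
  by (simp add: qone_def norm_Pair)

lemma qone_neq_0 [simp]: "qone \<noteq> 0"
  by (simp add: qone_def zero_prod_def)

lemma linear_qcnj: "linear qcnj"
  by (auto intro!: linearI quat_eqI simp: qcnj_def)

lemmas qcnj_simps = linear_add[OF linear_qcnj] linear_diff[OF linear_qcnj]
  linear_neg[OF linear_qcnj] linear_cmul[OF linear_qcnj] linear_0[OF linear_qcnj]

lemma qcnj_qcnj [simp]: "qcnj (qcnj p) = p"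
  by (simp add: qcnj_def)

lemma qcnj_qone [simp]: "qcnj qone = qone"
  by (simp add: qcnj_def qone_def)

lemma norm_qcnj [simp]: "norm (qcnj p) = norm p"
  by (simp add: qcnj_def norm_prod_def)

lemma qcnj_eq_0 [simp]: "qcnj p = 0 \<longleftrightarrow> p = 0"
  by (metis norm_qcnj norm_eq_zero)

lemma qcnj_qmult: "qcnj (p \<odot> q) = qcnj q \<odot> qcnj p"
  by (auto intro!: quat_eqI simp: qcnj_def qmult_def cross3_simps)

lemma qmult_qcnj': "p \<odot> qcnj p = (norm p)\<^sup>2 *\<^sub>R qone"
  by (simp add: qmult_qcnj qone_def)

lemma qcnj_qmult': "qcnj p \<odot> p = (norm p)\<^sup>2 *\<^sub>R qone"
  using qmult_qcnj'[of "qcnj p"] by simp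

lemma qmult_qcnj_cancel: "p \<odot> (qcnj p \<odot> q) = (norm p)\<^sup>2 *\<^sub>R q" "qcnj p \<odot> (p \<odot> q) = (norm p)\<^sup>2 *\<^sub>R q"
  by (simp_all add: qmult_assoc[symmetric] qmult_qcnj' qcnj_qmult' qmult.scaleR_left)

lemma norm_qmult: "norm (p \<odot> q) = norm p * norm q"
proof -
  have "(norm (p \<odot> q))\<^sup>2 *\<^sub>R qone = (norm p * norm q)\<^sup>2 *\<^sub>R qone"
    by (simp add: qmult_qcnj'[symmetric] qcnj_qmult qmult_assoc)
       (simp add: qmult_qcnj_cancel qmult.scaleR_right qmult.scaleR_left qmult_qcnj' power_mult_distrib
         qmult_assoc[symmetric])
  then show ?thesis by simp
qed

lemma qmult_eq_0: "p \<odot> q = 0 \<longleftrightarrow> p = 0 \<or> q = 0"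
  by (metis norm_qmult norm_eq_zero mult_eq_0_iff)

lemma qmult_left_cancel: "p \<noteq> 0 \<Longrightarrow> p \<odot> q = p \<odot> r \<longleftrightarrow> q = r"
  by (metis qmult.diff_right qmult_eq_0 right_minus_eq)

lemma qmult_right_cancel: "p \<noteq> 0 \<Longrightarrow> q \<odot> p = r \<odot> p \<longleftrightarrow> q = r"
  by (metis qmult.diff_left qmult_eq_0 right_minus_eq)

lemma inner_eq_fst: "p \<bullet> q = fst (p \<odot> qcnj q)"
  by (simp add: qmult_def qcnj_def inner_prod_def)

lemma inner_qmult_left: "(u \<odot> x) \<bullet> z = x \<bullet> (qcnj u \<odot> z)"
  by (simp add: inner_eq_fst qmult_def qcnj_def cross3_simps)

lemma inner_qmult_right: "(u \<odot> x) \<bullet> z = u \<bullet> (z \<odot> qcnj x)"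
  by (simp add: inner_eq_fst qmult_def qcnj_def cross3_simps)

lemma imag_cnj: "fst u = 0 \<Longrightarrow> qcnj u = - u"
  by (auto intro!: quat_eqI simp: qcnj_def)

lemma imag_square: "fst u = 0 \<Longrightarrow> u \<odot> u = - (norm u)\<^sup>2 *\<^sub>R qone"
  using qmult_qcnj'[of u] imag_cnj[of u] by (metis minus_minus qmult.minus_right scaleR_minus_left)

lemma imag_anticommute:
  assumes "fst u = 0" "fst v = 0" "u \<bullet> v = 0"
  shows "u \<odot> v = - (v \<odot> u)"
proof -
  have "snd v \<bullet> snd u = 0" using assms by (simp add: inner_prod_def inner_commute)
  then show ?thesis using assms cross_skew[of "snd u" "snd v"]
    by (simp add: qmult_def inner_prod_def prod_eq_iff)
qed

lemma qmult_unit_cancel: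
  assumes "norm c = 1"
  shows "c \<odot> qcnj c = qone" "qcnj c \<odot> c = qone" "c \<odot> (qcnj c \<odot> p) = p" "qcnj c \<odot> (c \<odot> p) = p"
  using assms by (simp_all add: qmult_qcnj' qcnj_qmult' qmult_qcnj_cancel)

definition qi :: quat where "qi = (0, axis 1 1)"
definition qj :: quat where "qj = (0, axis 2 1)"
definition qk :: quat where "qk = (0, axis 3 1)"

lemma qijk_imag [simp]: "fst qi = 0" "fst qj = 0" "fst qk = 0"
  by (simp_all add: qi_def qj_def qk_def)

lemma norm_qijk [simp]: "norm qi = 1" "norm qj = 1" "norm qk = 1"
  by (simp_all add: qi_def qj_def qk_def norm_Pair)

lemma qi_qj: "qi \<odot> qj = qk" "qi \<bullet> qj = 0"
  by (auto intro!: quat_eqI simp: qi_def qj_def qk_def qmult_def cross3_simps axis_def)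

lemma quat_expand:
  "p = fst p *\<^sub>R qone + (snd p $ 1) *\<^sub>R qi + (snd p $ 2) *\<^sub>R qj + (snd p $ 3) *\<^sub>R qk"
  by (auto intro!: quat_eqI simp: qi_def qj_def qk_def qone_def axis_def)

section \<open>Square roots, conjugation and automorphisms\<close>

text \<open>
  If \<open>c\<close> is a unit, then \<open>(1 + c)\<^sup>2 = 1 + 2 c + c\<^sup>2 = c \<bar>1 + c\<bar>\<^sup>2\<close>, so normalizing \<open>1 + c\<close> gives
  a root; only \<open>c = -1\<close> needs another one, any imaginary unit. This is what makes the determinant
  of \<open>(x, y) \<mapsto> (c x a, c y b)\<close> computable without coordinates.
\<close>
lemma unit_quat_sqrt:
  assumes "norm c = 1"
  obtains d where "norm d = 1" "d \<odot> d = c"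
proof (cases "c = - qone")
  case True
  then show ?thesis using that[of qi] imag_square[of qi] by simp
next
  case False
  define n where "n = norm (qone + c)"
  have n: "n \<noteq> 0" using False by (auto simp: n_def add_eq_0_iff)
  have "(qone + c) \<odot> (qone + c) = c \<odot> ((qone + c) \<odot> qcnj (qone + c))"
    using qmult_unit_cancel[OF assms]
    by (simp add: qcnj_simps qmult.add_left qmult.add_right algebra_simps)
  then have "(qone + c) \<odot> (qone + c) = n\<^sup>2 *\<^sub>R c"
    by (simp add: qmult_qcnj' qmult.scaleR_right n_def)
  then show ?thesis using n that[of "(1 / n) *\<^sub>R (qone + c)"]
    by (simp add: qmult.scaleR_right qmult.scaleR_left n_def power2_eq_square)
qed

text \<open>
  The rotation of imaginary space about the axis \<open>e\<close> that takes \<open>u\<close> to \<open>w\<close>. Both \<open>u\<close> and \<open>w\<close>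
  are square roots of \<open>-1\<close>, so \<open>1 - w u\<close> intertwines them: both \<open>(1 - w u) u\<close> and
  \<open>w (1 - w u)\<close> are \<open>u + w\<close>. It commutes with \<open>e\<close> because \<open>u\<close> and \<open>w\<close> both anticommute with \<open>e\<close>.
  It vanishes exactly when \<open>w = -u\<close>, and then \<open>e\<close> itself does the job.
\<close>
lemma conj_imag_orth:
  assumes e: "fst e = 0" "norm e = 1" and u: "fst u = 0" "norm u = 1" "u \<bullet> e = 0"
    and w: "fst w = 0" "norm w = 1" "w \<bullet> e = 0"
  obtains c where "norm c = 1" "c \<odot> u = w \<odot> c" "c \<odot> e = e \<odot> c"
proof (cases "w = - u")
  case True
  then show ?thesis using that[of e] e imag_anticommute[OF e(1) u(1)] u(3)
    by (simp add: inner_commute qmult.minus_left)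
next
  case False
  define d where "d = qone - w \<odot> u"
  have "d \<noteq> 0"
  proof
    assume "d = 0"
    then have "w \<odot> (w \<odot> u) = w" by (simp add: d_def)
    then have "w = - u" using imag_square[OF w(1)] w(2)
      by (simp add: qmult_assoc[symmetric] qmult.minus_left)
    with False show False ..
  qed
  have 1: "d \<odot> u = w \<odot> d"
    using imag_square[OF w(1)] imag_square[OF u(1)] w(2) u(2)
    by (simp add: d_def qmult.diff_left qmult.diff_right qmult_assoc[of w u u] qmult_assoc[of w w u, symmetric]
       qmult.minus_left qmult.minus_right)
  have ue: "u \<odot> e = - (e \<odot> u)" and we: "w \<odot> e = - (e \<odot> w)"
    using imag_anticommute e u w by blast+
  have "(w \<odot> u) \<odot> e = - (w \<odot> (e \<odot> u))" by (simp add: qmult_assoc ue qmult.minus_right)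
  also have "\<dots> = e \<odot> (w \<odot> u)"
    by (simp add: qmult_assoc[symmetric] we qmult.minus_left)
  finally have 2: "d \<odot> e = e \<odot> d"
    by (simp add: d_def qmult.diff_left qmult.diff_right)
  show ?thesis using that[of "(1 / norm d) *\<^sub>R d"] 1 2 \<open>d \<noteq> 0\<close>
    by (simp add: qmult.scaleR_right qmult.scaleR_left)
qed

lemma conj_imag:
  assumes u: "fst u = 0" and w: "fst w = 0" and uw: "norm u = norm w" and u0: "u \<noteq> 0"
  obtains c where "norm c = 1" "c \<odot> u = w \<odot> c"
proof -
  have "dim {snd u, snd w} < DIM(real ^ 3)"
    using dim_le_card'[of "{snd u, snd w}"] card_insert_le_m1[of 2 "{snd w}" "snd u"] by simp
  from orthogonal_to_subspace_exists[OF this]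
  obtain v where v: "v \<noteq> 0" "\<And>y. y \<in> span {snd u, snd w} \<Longrightarrow> orthogonal v y"
    by metis
  then have vu: "v \<bullet> snd u = 0" "v \<bullet> snd w = 0"
    by (auto simp: orthogonal_def span_base)
  define n where "n = norm u"
  define e :: quat where "e = (0, (1 / norm v) *\<^sub>R v)"
  have n: "n \<noteq> 0" "norm w = n" using u0 uw by (auto simp: n_def)
  obtain c where "norm c = 1" "c \<odot> ((1 / n) *\<^sub>R u) = ((1 / n) *\<^sub>R w) \<odot> c"
  proof (rule conj_imag_orth[of e "(1 / n) *\<^sub>R u" "(1 / n) *\<^sub>R w"])
    show "norm e = 1" using v(1) by (simp add: e_def norm_Pair)
  qed (use u w n vu in \<open>auto simp: e_def n_def inner_prod_def inner_commute\<close>)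
  then show ?thesis using that[of c] n by (simp add: qmult.scaleR_left qmult.scaleR_right)
qed

text \<open>
  The instance of the Skolem--Noether theorem that the classification of \<open>Ggrp\<close> needs. A first
  conjugation corrects the image of \<open>i\<close>, a second one, which fixes \<open>i\<close>, corrects the image of \<open>j\<close>;
  together \<open>i\<close> and \<open>j\<close> generate the quaternions.
\<close>
lemma inner_automorphism:
  assumes lin: "linear \<phi>" and iso: "\<And>u. norm (\<phi> u) = norm u"
    and mult: "\<And>u v. \<phi> (u \<odot> v) = \<phi> u \<odot> \<phi> v"
  obtains d where "norm d = 1" "\<And>u. \<phi> u = d \<odot> (u \<odot> qcnj d)"
proof -
  have one: "\<phi> qone = qone"
  proof -
    have "\<phi> qone \<odot> \<phi> qone = \<phi> qone \<odot> qone" by (simp add: mult[symmetric])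
    moreover have "\<phi> qone \<noteq> 0" using iso[of qone] by auto
    ultimately show ?thesis by (metis qmult_left_cancel)
  qed
  have dot: "\<phi> u \<bullet> \<phi> v = u \<bullet> v" for u v
    using iso lin orthogonal_transformation orthogonal_transformation_def by metis
  have re: "fst p = p \<bullet> qone" for p by (simp add: qone_def inner_prod_def)
  have im: "fst (\<phi> u) = 0" if "fst u = 0" for u
    using dot[of u qone] one that by (simp add: re)
  obtain c where c: "norm c = 1" "c \<odot> qi = \<phi> qi \<odot> c"
    using conj_imag[of qi "\<phi> qi"] im iso by (metis norm_qijk(1) qijk_imag(1) norm_zero zero_neq_one)
  \<comment> \<open>the image of \<open>j\<close> after \<open>i\<close> has been corrected; it is still orthogonal to \<open>1\<close> and \<open>i\<close>\<close>
  define w where "w = qcnj c \<odot> (\<phi> qj \<odot> c)"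
  have icc: "\<phi> qi = c \<odot> (qi \<odot> qcnj c)"
    using c qmult_unit_cancel[OF c(1)] by (metis qmult_assoc qone_mult(2))
  have win: "w \<bullet> z = \<phi> qj \<bullet> (c \<odot> (z \<odot> qcnj c))" for z
    unfolding w_def inner_qmult_left[of "qcnj c"] qcnj_qcnj
    by (subst inner_qmult_right) (simp add: qmult_assoc)
  have "fst w = 0"
    using win[of qone] qmult_unit_cancel(1)[OF c(1)] im[OF qijk_imag(2)] by (simp add: re)
  moreover have "w \<bullet> qi = 0"
    using dot[of qj qi] qi_qj(2) win[of qi] by (metis icc inner_commute)
  moreover have "norm w = 1" by (simp add: w_def norm_qmult c iso)
  moreover have "qj \<bullet> qi = 0" using qi_qj by (simp add: inner_commute)
  ultimately obtain b where b: "norm b = 1" "b \<odot> qj = w \<odot> b" "b \<odot> qi = qi \<odot> b"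
    using conj_imag_orth[of qi qj w] by (metis norm_qijk qijk_imag)
  define d where "d = c \<odot> b"
  have d: "norm d = 1" by (simp add: d_def norm_qmult b c)
  have comm: "d \<odot> qi = \<phi> qi \<odot> d" "d \<odot> qj = \<phi> qj \<odot> d"
    using qmult_unit_cancel[OF c(1)]
    by (simp_all add: d_def qmult_assoc b w_def) (simp add: qmult_assoc[symmetric] c)
  moreover have "d \<odot> qk = \<phi> qk \<odot> d"
    using comm by (metis qi_qj(1) mult qmult_assoc)
  ultimately have "d \<odot> u = \<phi> u \<odot> d" for u
    by (subst (1 2) quat_expand[of u])
      (simp add: linear_add[OF lin] linear_cmul[OF lin] one qmult.add_left qmult.add_right
        qmult.scaleR_left qmult.scaleR_right)
  then have "\<phi> u = d \<odot> (u \<odot> qcnj d)" for u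
    using qmult_unit_cancel[OF d] by (metis qmult_assoc qone_mult(2))
  then show ?thesis using that d by blast
qed

section \<open>The maps (x, y) to (c x a, c y b)\<close>

definition kmap :: "quat \<Rightarrow> quat \<Rightarrow> quat \<Rightarrow> oct \<Rightarrow> oct" where
  "kmap c a b = (\<lambda>(x, y). (c \<odot> (x \<odot> a), c \<odot> (y \<odot> b)))"

definition Kgrp :: "(oct \<Rightarrow> oct) set" where
  "Kgrp = {kmap c a b | c a b. norm c = 1 \<and> norm a = 1 \<and> norm b = 1}"

lemma linear_kmap: "linear (kmap c a b)"
  by (rule linearI)
    (simp_all add: kmap_def split_beta qmult.add_left qmult.add_right qmult.scaleR_left qmult.scaleR_right)

lemma kmap_compose: "kmap c a b \<circ> kmap c' a' b' = kmap (c \<odot> c') (a' \<odot> a) (b' \<odot> b)"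
  by (auto simp: kmap_def qmult_assoc)

lemma kmap_orthogonal:
  assumes "norm c = 1" "norm a = 1" "norm b = 1"
  shows "orthogonal_transformation (kmap c a b)"
  using assms linear_kmap
  by (auto simp: orthogonal_transformation kmap_def norm_Pair norm_qmult)

lemma Bform_kmap:
  assumes "norm a = 1" "norm b = 1"
  shows "Bform (kmap c a b q) (kmap c a b q') = c \<odot> (Bform q q' \<odot> qcnj c)"
proof (cases q; cases q')
  fix x y x' y' assume q: "q = (x, y)" "q' = (x', y')"
  show ?thesis using qmult_unit_cancel[OF assms(1)] qmult_unit_cancel[OF assms(2)]
    by (simp add: q Bform_def kmap_def qcnj_qmult qmult_assoc qmult.add_left qmult.add_right)
qed

definition det8 :: "(oct \<Rightarrow> oct) \<Rightarrow> real" where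
  "det8 g = det (matrix (to_R8 \<circ> g \<circ> of_R8))"

lemma linear_to_R8: "linear to_R8"
proof (rule linearI)
  show "to_R8 (p + q) = to_R8 p + to_R8 q" for p q
    by (metis linear_add[OF linear_of_R8] of_R8_to_R8 to_R8_of_R8)
  show "to_R8 (r *\<^sub>R p) = r *\<^sub>R to_R8 p" for r p
    by (metis linear_cmul[OF linear_of_R8] of_R8_to_R8 to_R8_of_R8)
qed

lemma det8_compose:
  assumes "linear g" "linear h"
  shows "det8 (g \<circ> h) = det8 g * det8 h"
proof -
  have *: "linear (to_R8 \<circ> f \<circ> of_R8)" if "linear f" for f
    by (intro linear_compose linear_of_R8 linear_to_R8 that)
  have "to_R8 \<circ> (g \<circ> h) \<circ> of_R8 = (to_R8 \<circ> g \<circ> of_R8) \<circ> (to_R8 \<circ> h \<circ> of_R8)"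
    by auto
  then show ?thesis
    unfolding det8_def by (simp only: matrix_compose[OF *[OF assms(2)] *[OF assms(1)]] det_mul)
qed

lemma det8_id: "det8 id = 1"
proof -
  have "to_R8 \<circ> id \<circ> of_R8 = id" by auto
  then show ?thesis by (simp add: det8_def matrix_id_mat_1)
qed

lemma det8_orthogonal:
  assumes "orthogonal_transformation g"
  shows "(det8 g)\<^sup>2 = 1"
proof -
  have "orthogonal_transformation (to_R8 \<circ> g \<circ> of_R8)"
    using assms linear_compose[OF linear_of_R8 linear_compose[OF orthogonal_transformation_linear[OF assms] linear_to_R8]]
    unfolding orthogonal_transformation_def
    by (metis comp_apply comp_assoc inner_of_R8 of_R8_to_R8)
  then have "orthogonal_matrix (matrix (to_R8 \<circ> g \<circ> of_R8))"
    by (simp add: orthogonal_transformation_matrix)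
  then show ?thesis using det_orthogonal_matrix by (fastforce simp: det8_def)
qed

text \<open>
  The equivalence is oriented so that, as a rewrite rule, it removes \<open>g\<close>.
\<close>
lemma Ggrp_iff:
  "g \<in> Ggrp \<longleftrightarrow> orthogonal_transformation g \<and> det8 g = 1 \<and> (\<forall>q q'. Bform (g q) (g q') = 0 \<longleftrightarrow> Bform q q' = 0)"
  unfolding Ggrp_def SO8_def det8_def by blast

lemma Ggrp_linear: "g \<in> Ggrp \<Longrightarrow> linear g"
  by (simp add: Ggrp_iff orthogonal_transformation_linear)

lemma Ggrp_compose: "g \<in> Ggrp \<Longrightarrow> h \<in> Ggrp \<Longrightarrow> g \<circ> h \<in> Ggrp"
  using orthogonal_transformation_compose[of g h]
  by (simp add: Ggrp_iff det8_compose orthogonal_transformation_linear)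

lemma Ggrp_inv:
  assumes "g \<in> Ggrp"
  obtains g' where "g' \<in> Ggrp" "g' \<circ> g = id" "g \<circ> g' = id"
proof -
  have g: "orthogonal_transformation g" using assms by (simp add: Ggrp_iff)
  then have b: "bij g" by (rule orthogonal_transformation_bij)
  then have 1: "inv g \<circ> g = id" "g \<circ> inv g = id"
    by (simp_all add: bij_def surj_iff)
  have o: "orthogonal_transformation (inv g)" using g by (rule orthogonal_transformation_inv)
  have "det8 (g \<circ> inv g) = 1" by (simp add: 1 det8_id)
  then have "det8 (inv g) = 1"
    using assms o by (simp add: det8_compose orthogonal_transformation_linear Ggrp_iff)
  moreover have "Bform (inv g q) (inv g q') = 0 \<longleftrightarrow> Bform q q' = 0" for q q'
    using assms 1 by (metis Ggrp_iff comp_apply id_apply)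
  ultimately show ?thesis using that[of "inv g"] o 1 by (simp add: Ggrp_iff)
qed

text \<open>
  The form is conjugated by \<open>c\<close>, so its zeros are preserved. For the determinant, every element
  is the square \<open>h \<circ> h\<close> of an orthogonal \<open>h\<close> of the same form, and
  \<open>det (h \<circ> h) = (det h)\<^sup>2 = 1\<close>.
\<close>
lemma Kgrp_subset_Ggrp: "Kgrp \<subseteq> Ggrp"
proof
  fix g assume "g \<in> Kgrp"
  then obtain c a b where g: "g = kmap c a b" and n: "norm c = 1" "norm a = 1" "norm b = 1"
    by (auto simp: Kgrp_def)
  obtain c' a' b' where s: "norm c' = 1" "c' \<odot> c' = c" "norm a' = 1" "a' \<odot> a' = a" "norm b' = 1" "b' \<odot> b' = b"
    using unit_quat_sqrt n by metis
  define h where "h = kmap c' a' b'"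
  have "g = h \<circ> h" by (simp add: g h_def kmap_compose s)
  then have "det8 g = (det8 h)\<^sup>2" by (simp add: det8_compose h_def linear_kmap power2_eq_square)
  then have "det8 g = 1" using det8_orthogonal[of h] kmap_orthogonal s by (simp add: h_def)
  moreover have "Bform (g q) (g q') = 0 \<longleftrightarrow> Bform q q' = 0" for q q'
    using n by (auto simp: g Bform_kmap qmult_eq_0)
  ultimately show "g \<in> Ggrp" using kmap_orthogonal[OF n] by (simp add: Ggrp_iff g)
qed

section \<open>The structure of the symmetry group\<close>

text \<open>
  Multiplications by quaternions adapted to the form: the component of \<open>Bform q q'\<close> along \<open>u\<close> is
  \<open>q \<bullet> mulJ u q'\<close>. The conjugate on the second factor makes \<open>u \<mapsto> mulJ u\<close> multiplicative on
  the first factor and antimultiplicative on the second, which is how elements of \<open>Ggrp\<close>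
  distinguish the two factors.
\<close>
definition mulJ :: "quat \<Rightarrow> oct \<Rightarrow> oct" where
  "mulJ u = (\<lambda>(x, y). (u \<odot> x, qcnj u \<odot> y))"

lemma inner_Bform: "u \<bullet> Bform q q' = q \<bullet> mulJ u q'"
proof (cases q; cases q')
  fix x y x' y' assume q: "q = (x, y)" "q' = (x', y')"
  have "u \<bullet> (x \<odot> qcnj x') = x \<bullet> (u \<odot> x')" "u \<bullet> (y' \<odot> qcnj y) = y \<bullet> (qcnj u \<odot> y')"
    by (metis inner_qmult_right inner_commute, metis inner_qmult_right inner_qmult_left inner_commute)
  then show ?thesis by (simp add: q Bform_def mulJ_def inner_add_right)
qed

lemma Bform_eq_0_iff: "Bform q q' = 0 \<longleftrightarrow> (\<forall>u. q \<bullet> mulJ u q' = 0)"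
  by (metis inner_Bform inner_zero_right inner_eq_zero_iff)

lemma linear_mulJ: "linear (mulJ u)"
  by (rule linearI) (simp_all add: mulJ_def split_beta qmult.add_right qmult.scaleR_right)

lemma linear_mulJ_left: "linear (\<lambda>u. mulJ u q)"
  by (rule linearI) (simp_all add: mulJ_def split_beta qmult.add_left qmult.scaleR_left qcnj_simps)

lemma norm_mulJ: "norm (mulJ u q) = norm u * norm q"
proof -
  obtain x y where q: "q = (x, y)" by (metis prod.collapse)
  have "(norm u * norm x)\<^sup>2 + (norm u * norm y)\<^sup>2 = (norm u)\<^sup>2 * ((norm x)\<^sup>2 + (norm y)\<^sup>2)"
    by (simp add: power_mult_distrib distrib_left)
  then show ?thesis by (simp add: q mulJ_def norm_Pair norm_qmult real_sqrt_mult)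
qed

text \<open>
  By \<open>inner_Bform\<close>, the zeros \<open>z\<close> of \<open>Bform z q\<close> are the orthogonal complement of the space
  \<open>A q\<close> of all \<open>mulJ w q\<close>. Hence \<open>g\<close> carries \<open>A q\<close> to \<open>A (g q)\<close>, so that the linear map
  \<open>T = inv g \<circ> mulJ u \<circ> g\<close> satisfies \<open>T q = mulJ (w q) q\<close>
  with a quaternion \<open>w q\<close> that could depend on \<open>q\<close>. Additivity of \<open>T\<close> on
  \<open>(x, y) = (x, 0) + (0, y)\<close> forces \<open>w (x, 0) = w (x, y) = w (0, y)\<close> for nonzero \<open>x\<close> and \<open>y\<close>,
  which leaves a single value.
\<close>
lemma intertwiner_exists:
  assumes g: "g \<in> Ggrp"
  obtains \<phi> where "\<And>u q. mulJ u (g q) = g (mulJ (\<phi> u) q)"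
proof -
  have ortho: "orthogonal_transformation g" and lin: "linear g"
    using g by (auto simp: Ggrp_iff orthogonal_transformation_linear)
  obtain g' where g': "g' \<in> Ggrp" "g' \<circ> g = id" "g \<circ> g' = id" using Ggrp_inv[OF g] .
  have gg': "g (g' q) = q" for q using g'(3) by (metis comp_apply id_apply)
  have lin': "linear g'" using g' Ggrp_linear by blast
  have "\<exists>w. \<forall>q. mulJ u (g q) = g (mulJ w q)" for u
  proof -
    define T where "T q = g' (mulJ u (g q))" for q
    have linT: "linear T"
      unfolding T_def using linear_compose[OF linear_compose[OF lin linear_mulJ] lin'] by (simp add: comp_def)
    have ex: "\<exists>w. T q = mulJ w q" for q
    proof -
      define A where "A = range (\<lambda>w. mulJ w q)"
      have sub: "subspace A" unfolding A_def using linear_mulJ_left by (simp add: linear_subspace_image)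
      have "z \<bullet> T q = 0" if "z \<in> A\<^sup>\<bottom>" for z
      proof -
        have "Bform z q = 0" using that
          by (auto simp: Bform_eq_0_iff A_def orthogonal_comp_def orthogonal_def inner_commute)
        then have "Bform (g z) (g q) = 0" using g by (simp add: Ggrp_iff)
        then have "g z \<bullet> g (T q) = 0" by (simp add: Bform_eq_0_iff T_def gg')
        then show ?thesis using ortho by (simp add: orthogonal_transformation_def)
      qed
      then have "T q \<in> A\<^sup>\<bottom>\<^sup>\<bottom>" by (auto simp: orthogonal_comp_def orthogonal_def)
      then show ?thesis using orthogonal_comp_self[OF sub] by (auto simp: A_def)
    qed
    then obtain w where w: "\<And>q. T q = mulJ (w q) q" by metis
    have const: "w (x, 0) = w (x, y)" "w (0, y) = w (x, y)" if "x \<noteq> 0" "y \<noteq> 0" for x y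
    proof -
      have "T (x, y) = T (x, 0) + T (0, y)" using linear_add[OF linT, of "(x, 0)" "(0, y)"] by simp
      then have "w (x, y) \<odot> x = w (x, 0) \<odot> x" "qcnj (w (x, y)) \<odot> y = qcnj (w (0, y)) \<odot> y"
        by (simp_all add: w mulJ_def)
      then show "w (x, 0) = w (x, y)" "w (0, y) = w (x, y)" using that
        by (metis qmult_right_cancel qcnj_qcnj)+
    qed
    define v where "v = w (qone, qone)"
    have v: "w (x, 0) = v" "w (0, x) = v" if "x \<noteq> 0" for x
      using const[of x qone] const[of qone qone] const[of qone x] that qone_neq_0 unfolding v_def by metis+
    have "T q = mulJ v q" for q
    proof -
      obtain x y where q: "q = (x, y)" by (metis prod.collapse)
      have 1: "T (x, 0) = mulJ v (x, 0)" by (cases "x = 0") (use v w in \<open>auto simp: mulJ_def\<close>)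
      have 2: "T (0, y) = mulJ v (0, y)" by (cases "y = 0") (use v w in \<open>auto simp: mulJ_def\<close>)
      show ?thesis using linear_add[OF linT, of "(x, 0)" "(0, y)"] linear_add[OF linear_mulJ, of v "(x, 0)" "(0, y)"] 1 2
        by (simp add: q)
    qed
    then show ?thesis unfolding T_def using gg' by metis
  qed
  then show ?thesis using that by metis
qed

text \<open>
  The kernel of \<open>F\<close> is stable under left multiplication by all values of \<open>\<phi>\<close>, hence by all
  quaternions, so it is trivial; multiplicativity can then be read off after applying \<open>F\<close>.
\<close>
lemma intertwiner_multiplicative:
  assumes lin: "linear F" and F: "F x0 \<noteq> 0" and surj: "surj \<phi>"
    and tw: "\<And>u x. u \<odot> F x = F (\<phi> u \<odot> x)"
  shows "\<phi> (u \<odot> v) = \<phi> u \<odot> \<phi> v"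
proof -
  have inj: "x = 0" if "F x = 0" for x
  proof (rule ccontr)
    assume "x \<noteq> 0"
    define r where "r = (norm x)\<^sup>2"
    obtain u where "\<phi> u = (1 / r) *\<^sub>R (x0 \<odot> qcnj x)" using surj by (metis surjD)
    then have "\<phi> u \<odot> x = x0" using \<open>x \<noteq> 0\<close>
      by (simp add: qmult.scaleR_left qmult_assoc qcnj_qmult' qmult.scaleR_right r_def)
    then show False using tw[of u x] F that by simp
  qed
  have "F (\<phi> (u \<odot> v)) = F (\<phi> u \<odot> \<phi> v)"
    using tw[of "u \<odot> v" qone] tw[of v qone] tw[of u "\<phi> v"] by (simp add: qmult_assoc)
  then have "F (\<phi> (u \<odot> v) - \<phi> u \<odot> \<phi> v) = 0" by (simp add: linear_diff[OF lin])
  then show ?thesis using inj by fastforce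
qed

lemma kmap_in_Kgrp: "norm c = 1 \<Longrightarrow> norm a = 1 \<Longrightarrow> norm b = 1 \<Longrightarrow> kmap c a b \<in> Kgrp"
  by (auto simp: Kgrp_def)

text \<open>
  Write \<open>g\<close> as a block matrix with rows \<open>(P, R)\<close> and \<open>(S, Q)\<close>. A nonzero \<open>P\<close> makes \<open>\<phi>\<close>
  multiplicative, whereas a nonzero \<open>R\<close> or \<open>S\<close> would make it antimultiplicative, which is
  incompatible with \<open>i j \<noteq> j i\<close>. So \<open>g\<close> is block diagonal. Since \<open>\<phi>\<close> is inner, say
  conjugation by \<open>d\<close>, the intertwining relations evaluated at \<open>1\<close> determine \<open>P\<close> and \<open>Q\<close>.
\<close>
lemma intertwined_in_Kgrp:
  assumes g: "orthogonal_transformation g"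
    and tw: "\<And>u q. mulJ u (g q) = g (mulJ (\<phi> u) q)"
    and lin\<phi>: "linear \<phi>" and iso: "\<And>u. norm (\<phi> u) = norm u"
    and x0: "fst (g (x0, 0)) \<noteq> 0"
  shows "g \<in> Kgrp"
proof -
  have ling: "linear g" using g by (rule orthogonal_transformation_linear)
  have inj: "inj \<phi>" using linear_injective_0[OF lin\<phi>] iso by (metis norm_eq_zero)
  have surj: "surj \<phi>" using lin\<phi> inj by (rule linear_inj_imp_surj)
  define P where "P x = fst (g (x, 0))" for x
  define S where "S x = snd (g (x, 0))" for x
  define R where "R y = fst (g (0, y))" for y
  define Q where "Q y = snd (g (0, y))" for y
  have lin1: "linear (\<lambda>x. (x, 0 :: quat))" and lin2: "linear (\<lambda>y. (0 :: quat, y))"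
    by (auto intro!: linearI)
  have lins: "linear P" "linear S" "linear R" "linear Q"
    unfolding P_def S_def R_def Q_def
    using linear_compose[OF linear_compose[OF lin1 ling] linear_fst]
      linear_compose[OF linear_compose[OF lin1 ling] linear_snd]
      linear_compose[OF linear_compose[OF lin2 ling] linear_fst]
      linear_compose[OF linear_compose[OF lin2 ling] linear_snd]
    by (simp_all add: comp_def)
  have comp: "g (x, 0) = (P x, S x)" "g (0, y) = (R y, Q y)" for x y
    by (simp_all add: P_def S_def R_def Q_def)
  have sum: "g (x, y) = (P x + R y, S x + Q y)" for x y
    using linear_add[OF ling, of "(x, 0)" "(0, y)"] comp by simp
  have tw': "u \<odot> P x = P (\<phi> u \<odot> x)" "qcnj u \<odot> S x = S (\<phi> u \<odot> x)"
    "u \<odot> R x = R (qcnj (\<phi> u) \<odot> x)" "qcnj u \<odot> Q x = Q (qcnj (\<phi> u) \<odot> x)" for u x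
    using tw[of u "(x, 0)"] tw[of u "(0, x)"] by (simp_all add: mulJ_def comp)
  have mult: "\<phi> (u \<odot> v) = \<phi> u \<odot> \<phi> v" for u v
    using intertwiner_multiplicative[OF lins(1) _ surj] tw' x0 P_def by metis
  have ncomm: "\<phi> (qi \<odot> qj) \<noteq> \<phi> (qj \<odot> qi)"
  proof
    assume "\<phi> (qi \<odot> qj) = \<phi> (qj \<odot> qi)"
    then have "qi \<odot> qj = qj \<odot> qi" using inj by (simp add: inj_eq)
    moreover have "qj \<odot> qi = - (qi \<odot> qj)" using imag_anticommute[of qj qi] qi_qj by (simp add: inner_commute)
    ultimately have "qk = - qk" using qi_qj(1) by simp
    then have "qk \<bullet> qk = - (qk \<bullet> qk)" by (metis inner_minus_left)
    moreover have "qk \<bullet> qk = 1" by (simp add: dot_square_norm)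
    ultimately show False by simp
  qed
  have surj_cnj: "surj qcnj" by (metis surjI qcnj_qcnj)
  have S0: "S x = 0" for x
  proof (rule ccontr)
    assume "S x \<noteq> 0"
    then have *: "\<phi> (qcnj (u \<odot> v)) = \<phi> (qcnj u) \<odot> \<phi> (qcnj v)" for u v
      using intertwiner_multiplicative[OF lins(2), of x "\<phi> \<circ> qcnj"] tw'(2) comp_surj[OF surj_cnj surj]
      by (metis comp_apply qcnj_qcnj)
    show False using *[of "qcnj qi" "qcnj qj"] mult ncomm by (simp add: qcnj_qmult)
  qed
  have R0: "R x = 0" for x
  proof (rule ccontr)
    assume "R x \<noteq> 0"
    then have *: "qcnj (\<phi> (u \<odot> v)) = qcnj (\<phi> u) \<odot> qcnj (\<phi> v)" for u v
      using intertwiner_multiplicative[OF lins(3), of x "qcnj \<circ> \<phi>"] tw'(3) comp_surj[OF surj surj_cnj]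
      by (metis comp_apply)
    have "\<phi> (u \<odot> v) = \<phi> v \<odot> \<phi> u" for u v
      using *[of u v] by (metis qcnj_qmult qcnj_qcnj)
    then show False using mult ncomm by metis
  qed
  obtain d where d: "norm d = 1" "\<And>u. \<phi> u = d \<odot> (u \<odot> qcnj d)"
    using inner_automorphism[OF lin\<phi> iso mult] by metis
  note dc = qmult_unit_cancel[OF d(1)]
  have P: "P x = qcnj d \<odot> (x \<odot> (d \<odot> P qone))" for x
    using tw'(1)[of "qcnj d \<odot> (x \<odot> d)" qone] dc by (simp add: d(2) qmult_assoc)
  have Q: "Q x = qcnj d \<odot> (x \<odot> (d \<odot> Q qone))" for x
    using tw'(4)[of "qcnj d \<odot> (qcnj x \<odot> d)" qone] dc by (simp add: d(2) qmult_assoc qcnj_qmult)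
  have "norm (P qone) = 1" "norm (Q qone) = 1"
    using orthogonal_transformation_norm[OF g, of "(qone, 0)"] orthogonal_transformation_norm[OF g, of "(0, qone)"]
    by (simp_all add: comp S0 R0 norm_Pair)
  moreover have "g = kmap (qcnj d) (d \<odot> P qone) (d \<odot> Q qone)"
  proof
    fix q :: oct obtain x y where q: "q = (x, y)" by (metis prod.collapse)
    show "g q = kmap (qcnj d) (d \<odot> P qone) (d \<odot> Q qone) q"
      unfolding q sum S0 R0 kmap_def by (simp add: P[of x, symmetric] Q[of y, symmetric])
  qed
  ultimately show ?thesis using d(1) kmap_in_Kgrp by (simp add: norm_qmult)
qed

text \<open>
  The other coset of \<open>Kgrp\<close> is that of the swap of the two factors. The swap exchanges \<open>mulJ u\<close>
  and \<open>mulJ (qcnj u)\<close>, so it reduces the case of a vanishing upper left block to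
  \<open>intertwined_in_Kgrp\<close>.
\<close>
lemma Ggrp_cases:
  assumes g: "g \<in> Ggrp"
  shows "g \<in> Kgrp \<or> prod.swap \<circ> g \<in> Kgrp"
proof -
  have ortho: "orthogonal_transformation g" and lin: "linear g"
    using g by (auto simp: Ggrp_iff orthogonal_transformation_linear)
  obtain \<phi> where \<phi>: "\<And>u q. mulJ u (g q) = g (mulJ (\<phi> u) q)" using intertwiner_exists[OF g] by metis
  have inj: "g q = g q' \<Longrightarrow> q = q'" for q q' using orthogonal_transformation_inj[OF ortho] by (simp add: inj_eq)
  have ng: "norm (g q) = norm q" for q using orthogonal_transformation_norm[OF ortho] .
  have nJ: "mulJ u (qone, 0) = (u, 0)" for u by (simp add: mulJ_def)
  have iso: "norm (\<phi> u) = norm u" for u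
  proof -
    have "norm (mulJ u (g (qone, 0))) = norm (mulJ (\<phi> u) (qone, 0))" by (simp only: \<phi> ng)
    then show ?thesis unfolding norm_mulJ ng by (simp add: norm_Pair)
  qed
  have lin\<phi>: "linear \<phi>"
  proof (rule linearI)
    fix u v r
    have "g (mulJ (\<phi> (u + v)) q) = g (mulJ (\<phi> u + \<phi> v) q)" for q
      by (simp add: \<phi>[symmetric] linear_add[OF linear_mulJ_left] linear_add[OF lin])
    then show "\<phi> (u + v) = \<phi> u + \<phi> v" using inj nJ by (metis prod.inject)
    have "g (mulJ (\<phi> (r *\<^sub>R u)) q) = g (mulJ (r *\<^sub>R \<phi> u) q)" for q
      by (simp add: \<phi>[symmetric] linear_cmul[OF linear_mulJ_left] linear_cmul[OF lin])
    then show "\<phi> (r *\<^sub>R u) = r *\<^sub>R \<phi> u" using inj nJ by (metis prod.inject)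
  qed
  show ?thesis
  proof (cases "fst (g (qone, 0)) = 0")
    case False
    then show ?thesis using intertwined_in_Kgrp[OF ortho \<phi> lin\<phi> iso] by blast
  next
    case True
    have lsw: "linear (prod.swap :: oct \<Rightarrow> oct)" by (auto intro!: linearI)
    have sw: "orthogonal_transformation (prod.swap :: oct \<Rightarrow> oct)"
      using lsw by (auto simp: orthogonal_transformation norm_Pair add.commute)
    have Jsw: "mulJ u (prod.swap q) = prod.swap (mulJ (qcnj u) q)" for u q
      by (cases q) (simp add: mulJ_def)
    have "snd (g (qone, 0)) \<noteq> 0"
    proof
      assume "snd (g (qone, 0)) = 0"
      then have "norm (g (qone, 0)) = 0" using True by (simp add: norm_prod_def)
      then show False unfolding ng by (simp add: norm_Pair)
    qed
    then have "prod.swap \<circ> g \<in> Kgrp"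
      using intertwined_in_Kgrp[OF orthogonal_transformation_compose[OF sw ortho], of "\<phi> \<circ> qcnj" qone]
        linear_compose[OF linear_qcnj lin\<phi>] iso by (simp add: Jsw \<phi>)
    then show ?thesis ..
  qed
qed

lemma connected_Kgrp: "connected Kgrp"
proof -
  let ?S = "sphere (0 :: quat) 1"
  have "connected ?S" by (rule connected_sphere) simp
  then have "connected (?S \<times> ?S \<times> ?S)" by (intro connected_Times)
  moreover have "continuous_on (?S \<times> ?S \<times> ?S) (\<lambda>(c, a, b). kmap c a b)"
    by (rule continuous_on_coordinatewise_then_product)
      (auto simp: kmap_def split_beta intro!: continuous_intros qmult.continuous_on)
  ultimately have "connected ((\<lambda>(c, a, b). kmap c a b) ` (?S \<times> ?S \<times> ?S))"
    by (rule connected_continuous_image[rotated])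
  moreover have "(\<lambda>(c, a, b). kmap c a b) ` (?S \<times> ?S \<times> ?S) = Kgrp"
    by (force simp: Kgrp_def)
  ultimately show ?thesis by simp
qed

lemma kmap_id: "kmap qone qone qone = id"
  by (auto simp: kmap_def)

lemma id_in_Kgrp: "id \<in> Kgrp"
  unfolding Kgrp_def using kmap_id norm_qone by (metis (mono_tags, lifting) mem_Collect_eq)

text \<open>
  \<open>Kgrp\<close> is connected as a continuous image of three 3-spheres. Conversely the length of the
  first component of \<open>g (1, 0)\<close> is continuous in \<open>g\<close> and takes only the values 1 (on \<open>Kgrp\<close>) and
  0 (on the other coset), so it is constant on the identity component.
\<close>
lemma G0grp_eq_Kgrp: "G0grp = Kgrp"
proof
  show "Kgrp \<subseteq> G0grp" unfolding G0grp_def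
    by (rule connected_component_maximal[OF id_in_Kgrp connected_Kgrp Kgrp_subset_Ggrp])
  show "G0grp \<subseteq> Kgrp"
  proof
    fix g assume g: "g \<in> G0grp"
    define f :: "(oct \<Rightarrow> oct) \<Rightarrow> real" where "f h = norm (fst (h (qone, 0)))" for h
    have G: "G0grp \<subseteq> Ggrp" unfolding G0grp_def by (rule connected_component_subset)
    have val: "h \<in> Kgrp \<Longrightarrow> f h = 1" "prod.swap \<circ> h \<in> Kgrp \<Longrightarrow> f h = 0" for h
    proof -
      show "h \<in> Kgrp \<Longrightarrow> f h = 1" by (auto simp: Kgrp_def f_def kmap_def norm_qmult)
      assume "prod.swap \<circ> h \<in> Kgrp"
      then obtain c a b where "prod.swap \<circ> h = kmap c a b" by (auto simp: Kgrp_def)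
      then have "prod.swap (h (qone, 0)) = kmap c a b (qone, 0)" by (metis comp_apply)
      then show "f h = 0" by (cases "h (qone, 0)") (auto simp: f_def kmap_def)
    qed
    have "continuous_on G0grp (\<lambda>h. h (qone, 0))"
      by (rule continuous_on_subset[OF continuous_on_product_coordinates]) simp
    then have "continuous_on G0grp f" unfolding f_def by (intro continuous_intros)
    moreover have "connected G0grp" by (simp add: G0grp_def)
    ultimately have conn: "connected (f ` G0grp)" by (metis connected_continuous_image)
    have range: "f ` G0grp \<subseteq> {0, 1}" using val Ggrp_cases G by fastforce
    have "id \<in> G0grp" using id_in_Kgrp \<open>Kgrp \<subseteq> G0grp\<close> by blast
    then have "1 \<in> f ` G0grp" using val(1)[OF id_in_Kgrp] by force
    moreover have "f g \<in> f ` G0grp" using g by blast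
    ultimately have "f g = 1" using conn range by (metis connected_finite_iff_sing finite.emptyI finite_insert finite_subset empty_iff singletonD)
    then show "g \<in> Kgrp" using Ggrp_cases[of g] val(2)[of g] g G by force
  qed
qed

section \<open>The cone over the open set of planes\<close>

definition Vcone :: "opair set" where
  "Vcone = {((x, y), (x', y')) | x y x' y'.
        (x, y) \<noteq> 0 \<and> (x', y') \<noteq> 0 \<and>
        norm (x, y) = norm (x', y') \<and> Bform (x, y) (x', y') = 0 \<and>
        0 < norm (qIm (x \<odot> qcnj x')) \<and>
        norm (qIm (x \<odot> qcnj x')) < 1 / 2 * (norm (x, y))\<^sup>2}"

lemma Vcone_iff: "((x, y), (x', y')) \<in> Vcone \<longleftrightarrow>
        (x, y) \<noteq> 0 \<and> (x', y') \<noteq> 0 \<and>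
        norm (x, y) = norm (x', y') \<and> Bform (x, y) (x', y') = 0 \<and>
        0 < norm (qIm (x \<odot> qcnj x')) \<and>
        norm (qIm (x \<odot> qcnj x')) < 1 / 2 * (norm (x, y))\<^sup>2"
  unfolding Vcone_def by simp

lemma norm_qIm_sq: "(norm (qIm (x \<odot> qcnj x')))\<^sup>2 = (norm x * norm x')\<^sup>2 - (x \<bullet> x')\<^sup>2"
proof -
  have "(norm (x \<odot> qcnj x'))\<^sup>2 = (fst (x \<odot> qcnj x'))\<^sup>2 + (norm (snd (x \<odot> qcnj x')))\<^sup>2"
    by (simp add: norm_prod_def)
  then show ?thesis by (simp add: norm_qmult qIm_def inner_eq_fst)
qed

lemma norm_Pair_sq: "(norm (x, y))\<^sup>2 = (norm x)\<^sup>2 + (norm y)\<^sup>2"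
  by (simp add: norm_Pair)

lemma fst_Bform: "fst (Bform q q') = q \<bullet> q'"
proof -
  have "mulJ qone q' = q'" by (simp add: mulJ_def split_beta)
  moreover have "qone \<bullet> p = fst p" for p by (simp add: qone_def inner_prod_def)
  ultimately show ?thesis using inner_Bform[of qone q q'] by simp
qed

text \<open>
  The vanishing of the form gives \<open>\<bar>x\<bar> \<bar>x'\<bar> = \<bar>y\<bar> \<bar>y'\<bar>\<close>. With
  \<open>\<bar>x\<bar>\<^sup>2 + \<bar>y\<bar>\<^sup>2 = \<bar>x'\<bar>\<^sup>2 + \<bar>y'\<bar>\<^sup>2 = N\<close> this becomes \<open>N (N - \<bar>x\<bar>\<^sup>2 - \<bar>x'\<bar>\<^sup>2) = 0\<close>.
\<close>
lemma isotropic_pair_norms: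
  assumes n: "norm (x, y) = norm (x', y')" and B: "Bform (x, y) (x', y') = 0"
  shows "(norm x)\<^sup>2 + (norm x')\<^sup>2 = (norm (x, y))\<^sup>2" "norm y = norm x'" "norm y' = norm x"
proof -
  have "x \<odot> qcnj x' = - (y' \<odot> qcnj y)" using B by (simp add: Bform_def eq_neg_iff_add_eq_0)
  then have "norm (x \<odot> qcnj x') = norm (y' \<odot> qcnj y)" by simp
  then have 1: "norm x * norm x' = norm y' * norm y" by (simp add: norm_qmult)
  define a b a' b' where "a = (norm x)\<^sup>2" "b = (norm y)\<^sup>2" "a' = (norm x')\<^sup>2" "b' = (norm y')\<^sup>2"
  note defs = this
  have 2: "a * a' = b * b'" using arg_cong[OF 1, of "\<lambda>t. t\<^sup>2"] by (simp add: defs power_mult_distrib)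
  have 3: "a + b = a' + b'" using arg_cong[OF n, of "\<lambda>t. t\<^sup>2"] by (simp add: defs norm_Pair_sq)
  have pos: "a \<ge> 0" "b \<ge> 0" "a' \<ge> 0" "b' \<ge> 0" by (simp_all add: defs)
  have "(a + b) * (a + b - (a + a')) = 0" using 2 3 by algebra
  then have 4: "a + a' = a + b" using pos 3 by auto
  then show "(norm x)\<^sup>2 + (norm x')\<^sup>2 = (norm (x, y))\<^sup>2" by (simp add: defs norm_Pair_sq)
  show "norm y = norm x'" "norm y' = norm x" using 3 4 by (simp_all add: defs)
qed

text \<open>
  This identity explains the upper bound in the description of \<open>V1\<close>: the imaginary part
  reaches half of \<open>\<bar>q\<bar>\<^sup>2\<close> exactly when \<open>x\<close> and \<open>x'\<close> are orthogonal of equal norm, which is what the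
  second condition in \<open>Uplanes\<close> excludes.
\<close>
lemma qIm_gap:
  assumes n: "norm (x, y) = norm (x', y')" and B: "Bform (x, y) (x', y') = 0"
  shows "(1 / 2 * (norm (x, y))\<^sup>2)\<^sup>2 - (norm (qIm (x \<odot> qcnj x')))\<^sup>2
    = (1 / 2 * ((norm x)\<^sup>2 - (norm x')\<^sup>2))\<^sup>2 + (x \<bullet> x')\<^sup>2"
  unfolding norm_qIm_sq isotropic_pair_norms(1)[OF assms, symmetric] by (simp add: power2_eq_square field_simps)

lemma qIm_less_iff:
  assumes n: "norm (x, y) = norm (x', y')" and B: "Bform (x, y) (x', y') = 0"
  shows "norm (qIm (x \<odot> qcnj x')) < 1 / 2 * (norm (x, y))\<^sup>2 \<longleftrightarrow> x \<bullet> x' \<noteq> 0 \<or> norm x \<noteq> norm x'"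
proof -
  have "norm (qIm (x \<odot> qcnj x')) < 1 / 2 * (norm (x, y))\<^sup>2 \<longleftrightarrow>
      0 < (1 / 2 * (norm (x, y))\<^sup>2)\<^sup>2 - (norm (qIm (x \<odot> qcnj x')))\<^sup>2"
    using power2_less_imp_less[of "norm (qIm (x \<odot> qcnj x'))" "1 / 2 * (norm (x, y))\<^sup>2"]
      power_strict_mono[of "norm (qIm (x \<odot> qcnj x'))" "1 / 2 * (norm (x, y))\<^sup>2" 2] by auto
  also have "\<dots> \<longleftrightarrow> x \<bullet> x' \<noteq> 0 \<or> (norm x)\<^sup>2 \<noteq> (norm x')\<^sup>2"
    unfolding qIm_gap[OF assms] sum_power2_gt_zero_iff by auto
  finally show ?thesis by simp
qed

lemma qIm_pos_iff: "0 < norm (qIm (x \<odot> qcnj x')) \<longleftrightarrow> x \<noteq> x' \<and> independent {x, x'}"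
proof -
  have "0 < norm (qIm (x \<odot> qcnj x')) \<longleftrightarrow> (norm (qIm (x \<odot> qcnj x')))\<^sup>2 \<noteq> 0" by simp
  also have "\<dots> \<longleftrightarrow> \<bar>x \<bullet> x'\<bar> \<noteq> norm x * norm x'"
    unfolding norm_qIm_sq by (metis abs_mult abs_norm_cancel eq_iff_diff_eq_0 power2_abs power2_eq_iff_nonneg abs_ge_zero)
  also have "\<dots> \<longleftrightarrow> x' \<noteq> 0 \<and> x \<notin> span {x'}"
    unfolding insert_commute[of x] norm_cauchy_schwarz_equal
    using collinear_lemma[of x' x] by (auto simp: insert_commute span_singleton)
  also have "\<dots> \<longleftrightarrow> x \<noteq> x' \<and> independent {x, x'}"
    by (auto simp: independent_insert span_base)
  finally show ?thesis .
qed

lemma Vcone_scale: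
  assumes "p \<in> Vcone" "r > 0" shows "r *\<^sub>R p \<in> Vcone"
proof -
  obtain x y x' y' where p: "p = ((x, y), (x', y'))" by (metis prod.collapse)
  have i: "Bform (r *\<^sub>R x, r *\<^sub>R y) (r *\<^sub>R x', r *\<^sub>R y') = (r * r) *\<^sub>R Bform (x, y) (x', y')"
    by (simp add: Bform_def qmult.scaleR_left qmult.scaleR_right qcnj_simps scaleR_add_right)
  have n: "norm (r *\<^sub>R x, r *\<^sub>R y) = r * norm (x, y)" for x y :: quat
    using assms(2) by (simp flip: scaleR_Pair)
  have m: "qIm (r *\<^sub>R x \<odot> qcnj (r *\<^sub>R x')) = r\<^sup>2 *\<^sub>R qIm (x \<odot> qcnj x')"
    by (simp add: qIm_def qmult.scaleR_left qmult.scaleR_right qcnj_simps power2_eq_square)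
  have "r\<^sup>2 > 0" using assms(2) by simp
  then show ?thesis using assms unfolding p scaleR_Pair Vcone_iff i n m
    by (auto simp: power_mult_distrib mult.left_commute[of _ "r\<^sup>2"] prod_eq_iff)
qed

lemma Bform_self: "Bform q q = (norm q)\<^sup>2 *\<^sub>R qone"
proof -
  obtain x y where "q = (x, y)" by (metis prod.collapse)
  then show ?thesis by (simp add: Bform_def qmult_qcnj' norm_Pair_sq scaleR_add_left)
qed

lemma Bform_swap: "Bform q' q = qcnj (Bform q q')"
  by (simp add: Bform_def split_beta qcnj_simps qcnj_qmult)

lemma Bform_comb: "Bform (a *\<^sub>R q + b *\<^sub>R q') (c *\<^sub>R q + d *\<^sub>R q') =
   (a * c) *\<^sub>R Bform q q + (a * d) *\<^sub>R Bform q q' + (b * c) *\<^sub>R Bform q' q + (b * d) *\<^sub>R Bform q' q'"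
  by (simp add: Bform_def split_beta qcnj_simps qmult.add_left qmult.add_right
      qmult.scaleR_left qmult.scaleR_right algebra_simps)

text \<open>
  In the product \<open>X (qcnj X')\<close> the terms in \<open>\<bar>x\<bar>\<^sup>2\<close> and \<open>\<bar>x'\<bar>\<^sup>2\<close> are real, and \<open>x' (qcnj x)\<close> is the
  conjugate of \<open>x (qcnj x')\<close>. The imaginary part is therefore multiplied by
  \<open>(cos \<theta>)\<^sup>2 + (sin \<theta>)\<^sup>2 = 1\<close>.
\<close>
lemma rot_invariants:
  assumes n: "norm (x, y) = norm (x', y')" and B: "Bform (x, y) (x', y') = 0"
    and r: "rot \<theta> ((x, y), (x', y')) = ((X, Y), (X', Y'))"
  shows "norm (X, Y) = norm (x, y)" "norm (X', Y') = norm (x, y)" "Bform (X, Y) (X', Y') = 0"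
    "qIm (X \<odot> qcnj X') = qIm (x \<odot> qcnj x')"
proof -
  define q q' where "q = (x, y)" "q' = (x', y')" note qdef = this
  define c s where "c = cos \<theta>" "s = sin \<theta>" note csdef = this
  have cs: "c * c + s * s = 1" using sin_cos_squared_add[of \<theta>] by (simp add: csdef power2_eq_square)
  have W: "norm q = norm q'" "Bform q q' = 0"
    using n B unfolding qdef by blast+
  have B': "Bform q' q = 0" using Bform_swap[of q' q] W(2) by (simp add: qcnj_simps)
  have Q: "(X, Y) = c *\<^sub>R q + s *\<^sub>R q'" "(X', Y') = (- s) *\<^sub>R q + c *\<^sub>R q'"
    and X: "X = c *\<^sub>R x + s *\<^sub>R x'" "X' = (- s) *\<^sub>R x + c *\<^sub>R x'"
    using r by (auto simp: rot_def qdef csdef)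
  have o: "q \<bullet> q' = 0" using fst_Bform[of q q'] W(2) by simp
  have "(norm (a *\<^sub>R q + b *\<^sub>R q'))\<^sup>2 = (a * a + b * b) * (norm q)\<^sup>2" for a b
    using o W(1) unfolding power2_norm_eq_inner
    by (simp add: inner_add_left inner_add_right inner_commute norm_eq_sqrt_inner algebra_simps)
  from this[of c s] this[of "-s" c]
  have "(norm (X, Y))\<^sup>2 = (norm q)\<^sup>2" "(norm (X', Y'))\<^sup>2 = (norm q)\<^sup>2"
    using cs by (simp_all add: Q add.commute)
  then show "norm (X, Y) = norm (x, y)" "norm (X', Y') = norm (x, y)"
    unfolding qdef by simp_all
  show "Bform (X, Y) (X', Y') = 0" unfolding Q Bform_comb Bform_self W(2) B' using W(1) by simp
  show "qIm (X \<odot> qcnj X') = qIm (x \<odot> qcnj x')"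
  proof -
    have re: "snd (z \<odot> qcnj z) = 0" for z by (simp add: qmult_qcnj)
    have im: "snd (qcnj z) = - snd z" for z by (simp add: qcnj_def)
    have "X \<odot> qcnj X' = (- s * c) *\<^sub>R (x \<odot> qcnj x) + (s * c) *\<^sub>R (x' \<odot> qcnj x')
       + (c * c) *\<^sub>R (x \<odot> qcnj x') - (s * s) *\<^sub>R qcnj (x \<odot> qcnj x')"
      by (simp add: X qcnj_simps qcnj_qmult qmult.add_left qmult.add_right qmult.diff_left qmult.diff_right
        qmult.minus_left qmult.minus_right qmult.scaleR_left qmult.scaleR_right algebra_simps)
    then have "qIm (X \<odot> qcnj X') = (c * c + s * s) *\<^sub>R qIm (x \<odot> qcnj x')"
      by (simp add: qIm_def re im scaleR_add_left)
    then show ?thesis using cs by simp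
  qed
qed

lemma Vcone_rot:
  assumes "p \<in> Vcone" shows "rot \<theta> p \<in> Vcone"
proof -
  obtain x y x' y' where p: "p = ((x, y), (x', y'))" by (metis prod.collapse)
  obtain X Y X' Y' where r: "rot \<theta> p = ((X, Y), (X', Y'))" by (metis prod.collapse)
  note W = assms[unfolded p Vcone_iff]
  have "norm (x, y) = norm (x', y')" "Bform (x, y) (x', y') = 0" using W by blast+
  note inv = rot_invariants[OF this r[unfolded p]]
  have "(X, Y) \<noteq> 0" "(X', Y') \<noteq> 0" using inv(1,2) W by (metis norm_eq_zero)+
  then show ?thesis unfolding r Vcone_iff inv using W by blast
qed

lemma Vpairs_in_Vcone_iff:
  assumes "((x, y), (x', y')) \<in> Vpairs"
  shows "((x, y), (x', y')) \<in> Vcone \<longleftrightarrow> x \<noteq> x' \<and> independent {x, x'} \<and> \<bar>x \<bullet> x'\<bar> + \<bar>norm x - norm x'\<bar> \<noteq> 0"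
proof -
  have a: "norm (x, y) = 1" "norm (x', y') = 1" "Bform (x, y) (x', y') = 0"
    using assms by (auto simp: Vpairs_def)
  then have "norm (x, y) = norm (x', y')" by simp
  note * = qIm_less_iff[OF this a(3)]
  have "(x, y) \<noteq> 0" "(x', y') \<noteq> 0" using a by (metis norm_zero zero_neq_one)+
  then show ?thesis using a unfolding Vcone_iff * qIm_pos_iff by auto
qed

lemma oplane_scale:
  assumes "r > 0" shows "oplane (r *\<^sub>R p) = oplane p"
proof (cases p rule: prod.exhaust)
  case (Pair q q')
  have "oplane (r *\<^sub>R (q, q')) \<subseteq> oplane (q, q')" if "r > 0" for r and q q' :: oct
    using oplane_comb_subset[of r r 0 0 q q'] that by simp
  from this[OF assms, of q q'] this[of "1 / r" "r *\<^sub>R q" "r *\<^sub>R q'"] assms show ?thesis by (auto simp: Pair)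
qed

lemma Vcone_normalize:
  assumes "p \<in> Vcone"
  obtains r v where "r > 0" "v \<in> Vpairs" "p = r *\<^sub>R v" "v \<in> Vcone" "r = norm (fst p)"
proof -
  obtain x y x' y' where p: "p = ((x, y), (x', y'))" by (metis prod.collapse)
  define r where "r = norm (x, y)"
  define v where "v = (1 / r) *\<^sub>R p"
  have r: "r > 0" using assms by (simp add: p Vcone_iff r_def)
  have v: "v \<in> Vcone" using Vcone_scale[OF assms, of "1 / r"] r by (simp add: v_def)
  have "norm (fst v) = 1" using r by (simp add: v_def p r_def del: scaleR_Pair)
  then have "v \<in> Vpairs" using v by (cases v) (auto simp: Vpairs_def Vcone_def)
  then show ?thesis using that[OF r _ _ v] r by (simp add: v_def p r_def)
qed

text \<open>
  Membership in \<open>Uplanes\<close> asks for one good representative of the plane; since \<open>Vcone\<close> is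
  invariant under rotations, every representative is then good.
\<close>
lemma V1_eq_Vcone: "V1 = Vcone"
proof (intro equalityI subsetI)
  fix p assume "p \<in> V1"
  then obtain r v where r: "r > 0" "p = r *\<^sub>R v" "v \<in> Vpairs" "oplane v \<in> Uplanes"
    by (auto simp: V1_def piSO2_def)
  from r(4) obtain x y x' y' where e: "oplane v = oplane ((x, y), (x', y'))" and V: "((x, y), (x', y')) \<in> Vpairs"
    and "x \<noteq> x' \<and> independent {x, x'} \<and> \<bar>x \<bullet> x'\<bar> + \<bar>norm x - norm x'\<bar> \<noteq> 0"
    unfolding Uplanes_def mem_Collect_eq by blast
  then have "((x, y), (x', y')) \<in> Vcone" using Vpairs_in_Vcone_iff by blast
  moreover obtain \<theta> where "v = rot \<theta> ((x, y), (x', y'))"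
    using oplane_eq_iff_rot[OF V r(3)] e by auto
  ultimately show "p \<in> Vcone" using Vcone_scale Vcone_rot r by blast
next
  fix p assume "p \<in> Vcone"
  then obtain r v where r: "r > 0" "v \<in> Vpairs" "p = r *\<^sub>R v" "v \<in> Vcone" by (rule Vcone_normalize)
  obtain x y x' y' where v: "v = ((x, y), (x', y'))" by (metis prod.collapse)
  have "oplane v \<in> Uplanes"
    using r Vpairs_in_Vcone_iff[of x y x' y'] unfolding Uplanes_def Qplanes_def v by blast
  then show "p \<in> V1" using r by (auto simp: V1_def piSO2_def)
qed

section \<open>Actions of rotations, dilations and symmetries\<close>

lemma rot_scalar: "sin \<psi> = 0 \<Longrightarrow> rot \<psi> p = cos \<psi> *\<^sub>R p"
  by (cases p rule: prod.exhaust) (simp add: rot_def)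

lemma act_rot: "linear g \<Longrightarrow> act g (rot \<theta> p) = rot \<theta> (act g p)"
  by (cases p rule: prod.exhaust) (simp add: rot_def act_def linear_add linear_cmul linear_diff linear_neg)

lemma act_scale: "linear g \<Longrightarrow> act g (r *\<^sub>R p) = r *\<^sub>R act g p"
  by (cases p rule: prod.exhaust) (simp add: act_def linear_cmul)

lemma act_comp: "act (g \<circ> h) p = act g (act h p)"
  by (cases p rule: prod.exhaust) (simp add: act_def)

lemma dil_scale: "dil \<alpha> \<beta> (r *\<^sub>R p) = r *\<^sub>R dil \<alpha> \<beta> p"
  by (simp add: dil_def split_beta mult.commute)

lemma rot_scale: "rot \<theta> (r *\<^sub>R p) = r *\<^sub>R rot \<theta> p"
  by (cases p rule: prod.exhaust) (simp add: rot_def scaleR_add_right scaleR_diff_right mult.commute)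

lemma rot_minus: "rot \<theta> (- p) = - rot \<theta> p"
  using rot_scale[of \<theta> "-1" p] by simp

lemma rot_inverse: "rot (- \<theta>) (rot \<theta> p) = p" "rot \<theta> (rot (- \<theta>) p) = p"
  by (simp_all add: rot_rot) (simp_all add: rot_def split_beta)

lemma act_kmap_dil: "g \<in> Kgrp \<Longrightarrow> act g (dil \<alpha> \<beta> p) = dil \<alpha> \<beta> (act g p)"
  by (auto simp: Kgrp_def kmap_def act_def dil_def split_beta qmult.scaleR_left qmult.scaleR_right)

section \<open>Normal form and transitivity\<close>

text \<open>
  Rotating by \<open>\<theta>\<close> turns \<open>x \<bullet> x'\<close> into a combination of \<open>cos (2 \<theta>)\<close> and \<open>sin (2 \<theta>)\<close>, which has
  a zero.
\<close>
lemma rot_orthogonal_exists: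
  obtains \<theta> X Y X' Y' where "rot \<theta> p = ((X, Y), (X', Y'))" "X \<bullet> X' = 0"
proof -
  obtain x y x' y' where p: "p = ((x, y), (x', y'))" by (metis prod.collapse)
  define A B where "A = x \<bullet> x'" "B = ((norm x')\<^sup>2 - (norm x)\<^sup>2) / 2" note AB = this
  \<comment> \<open>\<open>A cos \<phi> + B sin \<phi>\<close> is the inner product after rotation by \<open>\<phi> / 2\<close>\<close>
  obtain \<phi> where \<phi>: "cos \<phi> * A + sin \<phi> * B = 0"
  proof (cases "A = 0 \<and> B = 0")
    case True then show ?thesis using that[of 0] by simp
  next
    case False
    define r where "r = sqrt (A\<^sup>2 + B\<^sup>2)"
    have r: "r\<^sup>2 = A\<^sup>2 + B\<^sup>2" "r \<noteq> 0" using False by (auto simp: r_def sum_power2_eq_zero_iff)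
    have "(B / r)\<^sup>2 + (- A / r)\<^sup>2 = (A\<^sup>2 + B\<^sup>2) / r\<^sup>2" by (simp add: power_divide add_divide_distrib)
    then have "(B / r)\<^sup>2 + (- A / r)\<^sup>2 = 1" unfolding r(1)[symmetric] using r(2) by simp
    then obtain \<phi> where "B / r = cos \<phi>" "- A / r = sin \<phi>" by (metis sincos_total_2pi)
    then show ?thesis using that[of \<phi>] by (metis add.commute add.right_inverse minus_divide_left mult.commute mult_minus_left times_divide_eq_left)
  qed
  define \<theta> where "\<theta> = \<phi> / 2"
  define c s where "c = cos \<theta>" "s = sin \<theta>" note cs = this
  have ang: "cos \<phi> = c\<^sup>2 - s\<^sup>2" "sin \<phi> = 2 * s * c"
    using cos_double[of \<theta>] sin_double[of \<theta>] by (simp_all add: \<theta>_def cs)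
  have "(c *\<^sub>R x + s *\<^sub>R x') \<bullet> ((- s) *\<^sub>R x + c *\<^sub>R x') = (c\<^sup>2 - s\<^sup>2) * A + 2 * s * c * B"
    unfolding AB power2_norm_eq_inner
    by (simp add: inner_add_left inner_add_right inner_diff_left inner_diff_right inner_commute power2_eq_square field_simps)
  also have "\<dots> = 0" using \<phi> ang by simp
  finally show ?thesis using that[of \<theta>] by (simp add: rot_def p cs)
qed

lemma Vcone_orthogonal_norms:
  assumes W: "((x, y), (x', y')) \<in> Vcone" and o: "x \<bullet> x' = 0"
  shows "x \<noteq> 0" "x' \<noteq> 0" "norm x \<noteq> norm x'" "norm x * norm x' = norm (qIm (x \<odot> qcnj x'))"
    "(norm x)\<^sup>2 + (norm x')\<^sup>2 = (norm (x, y))\<^sup>2" "norm y = norm x'" "norm y' = norm x"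
proof -
  have n: "norm (x, y) = norm (x', y')" and B: "Bform (x, y) (x', y') = 0" and p: "0 < norm (qIm (x \<odot> qcnj x'))"
    using W unfolding Vcone_iff by blast+
  show "norm x \<noteq> norm x'" using W qIm_less_iff[OF n B] o unfolding Vcone_iff by blast
  have "(norm (qIm (x \<odot> qcnj x')))\<^sup>2 = (norm x * norm x')\<^sup>2" using norm_qIm_sq[of x x'] o by simp
  then show e: "norm x * norm x' = norm (qIm (x \<odot> qcnj x'))" by (metis norm_ge_zero power2_eq_iff_nonneg mult_nonneg_nonneg)
  show "x \<noteq> 0" "x' \<noteq> 0" using e p by auto
qed (use W isotropic_pair_norms Vcone_iff in metis)+

text \<open>
  On \<open>Vcone\<close> orthogonal first components have different norms, and a quarter turn exchanges them
  up to sign.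
\<close>
lemma orth_rot_normal_form:
  assumes W: "((x, y), (x', y')) \<in> Vcone"
  obtains \<theta> X Y X' Y' where "rot \<theta> ((x, y), (x', y')) = ((X, Y), (X', Y'))" "X \<bullet> X' = 0" "norm X < norm X'"
proof -
  obtain \<theta> X Y X' Y' where r: "rot \<theta> ((x, y), (x', y')) = ((X, Y), (X', Y'))" "X \<bullet> X' = 0"
    by (rule rot_orthogonal_exists)
  have "norm X \<noteq> norm X'" using Vcone_orthogonal_norms(3)[OF _ r(2)] Vcone_rot[OF W, of \<theta>] r(1) by metis
  then consider "norm X < norm X'" | "norm X' < norm X" by linarith
  then show ?thesis
  proof cases
    case 1 then show ?thesis using that r by blast
  next
    case 2
    have "rot (pi / 2 + \<theta>) ((x, y), (x', y')) = ((X', Y'), (- X, - Y))"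
      by (simp flip: rot_rot add: r(1)) (simp add: rot_def)
    then show ?thesis using that[of "pi / 2 + \<theta>" X' Y' "- X" "- Y"] 2 r(2) by (simp add: inner_commute)
  qed
qed

text \<open>
  Choose \<open>c\<close> so that conjugation by it takes the imaginary quaternion \<open>x (qcnj x')\<close> to
  \<open>X (qcnj X')\<close>, then \<open>a\<close> so that \<open>c x a = X\<close> and \<open>b\<close> so that \<open>c y b = Y\<close>. The images of \<open>x'\<close>
  and \<open>y'\<close> are then forced by \<open>x (qcnj x') = - y' (qcnj y)\<close>.
\<close>
lemma kmap_transitive:
  assumes B: "Bform (x, y) (x', y') = 0" and B2: "Bform (X, Y) (X', Y') = 0"
    and o: "x \<bullet> x' = 0" "X \<bullet> X' = 0"
    and n: "norm X = norm x" "norm X' = norm x'" "norm Y = norm y" and nz: "x \<noteq> 0" "x' \<noteq> 0" "y \<noteq> 0"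
  obtains g where "g \<in> Kgrp" "act g ((x, y), (x', y')) = ((X, Y), (X', Y'))"
proof -
  define u w where "u = x \<odot> qcnj x'" "w = X \<odot> qcnj X'" note uw = this
  have "fst u = 0" "fst w = 0" using o by (simp_all add: uw flip: inner_eq_fst)
  moreover have "norm u = norm w" "u \<noteq> 0" using n nz by (simp_all add: uw norm_qmult qmult_eq_0)
  ultimately obtain c where c: "norm c = 1" "c \<odot> u = w \<odot> c" by (rule conj_imag)
  note cc = qmult_unit_cancel[OF c(1)]
  have w: "w = c \<odot> (u \<odot> qcnj c)" using c(2) cc by (metis qmult_assoc qone_mult(2))
  define a where "a = (1 / (norm x)\<^sup>2) *\<^sub>R (qcnj (c \<odot> x) \<odot> X)"
  define b where "b = (1 / (norm y)\<^sup>2) *\<^sub>R (qcnj (c \<odot> y) \<odot> Y)"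
  have div: "(1 / (norm x)\<^sup>2) *\<^sub>R ((c \<odot> x) \<odot> (qcnj (c \<odot> x) \<odot> z)) = z" if "x \<noteq> 0" for x z
    using that c(1) by (simp only: qmult_qcnj_cancel norm_qmult) simp
  have 1: "c \<odot> (x \<odot> a) = X" "c \<odot> (y \<odot> b) = Y"
    using div[OF nz(1), of X] div[OF nz(3), of Y] unfolding a_def b_def qmult.scaleR_right qmult_assoc[symmetric] .
  have "norm X = norm x * norm a" "norm Y = norm y * norm b"
    using arg_cong[OF 1(1), of norm] arg_cong[OF 1(2), of norm] c(1) by (simp_all add: norm_qmult)
  then have ab: "norm a = 1" "norm b = 1" using n nz by auto
  have Bx: "x \<odot> qcnj x' = - (y' \<odot> qcnj y)" "X \<odot> qcnj X' = - (Y' \<odot> qcnj Y)"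
    using B B2 by (simp_all add: Bform_def eq_neg_iff_add_eq_0)
  have "X \<odot> qcnj X' = X \<odot> qcnj (c \<odot> (x' \<odot> a))"
  proof -
    have "X \<odot> qcnj (c \<odot> (x' \<odot> a)) = (c \<odot> (x \<odot> a)) \<odot> qcnj (c \<odot> (x' \<odot> a))" by (simp only: 1)
    also have "\<dots> = w" unfolding w uw(1) using qmult_unit_cancel[OF ab(1)] by (simp add: qcnj_qmult qmult_assoc)
    finally show ?thesis by (simp add: uw)
  qed
  moreover have "X \<noteq> 0" "Y \<noteq> 0" using n nz by auto
  ultimately have 2: "X' = c \<odot> (x' \<odot> a)" by (metis qmult_left_cancel qcnj_qcnj)
  have "(c \<odot> (y' \<odot> b)) \<odot> qcnj Y = (c \<odot> (y' \<odot> b)) \<odot> qcnj (c \<odot> (y \<odot> b))" by (simp only: 1)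
  also have "\<dots> = c \<odot> ((y' \<odot> qcnj y) \<odot> qcnj c)" using qmult_unit_cancel[OF ab(2)] by (simp add: qcnj_qmult qmult_assoc)
  also have "\<dots> = - w" unfolding w uw(1) Bx(1) by (simp add: qmult.minus_left qmult.minus_right)
  also have "\<dots> = Y' \<odot> qcnj Y" using Bx(2) by (simp add: uw)
  finally have 3: "c \<odot> (y' \<odot> b) = Y'" using \<open>Y \<noteq> 0\<close> by (metis qmult_right_cancel qcnj_eq_0)
  have "act (kmap c a b) ((x, y), (x', y')) = ((X, Y), (X', Y'))"
    using 1 2 3 by (simp add: act_def kmap_def)
  then show ?thesis using that kmap_in_Kgrp[OF c(1) ab] by blast
qed

section \<open>Stabilizers\<close>

lemma rot_norm_rigid:
  fixes x x' :: quat
  assumes "x \<bullet> x' = 0" "norm x \<noteq> norm x'"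
  shows "norm (cos \<psi> *\<^sub>R x + sin \<psi> *\<^sub>R x') = norm x \<Longrightarrow> sin \<psi> = 0"
    "norm (cos \<psi> *\<^sub>R x + sin \<psi> *\<^sub>R x') = norm x' \<Longrightarrow> cos \<psi> = 0"
proof -
  have 1: "(norm (cos \<psi> *\<^sub>R x + sin \<psi> *\<^sub>R x'))\<^sup>2 = (cos \<psi>)\<^sup>2 * (norm x)\<^sup>2 + (sin \<psi>)\<^sup>2 * (norm x')\<^sup>2"
    using assms(1) unfolding power2_norm_eq_inner
    by (simp add: inner_add_left inner_add_right inner_commute power2_eq_square)
  have 2: "(norm x)\<^sup>2 - (norm x')\<^sup>2 \<noteq> 0" using assms(2) by simp
  have 3: "(sin \<psi>)\<^sup>2 + (cos \<psi>)\<^sup>2 = 1" by simp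
  show "sin \<psi> = 0" if "norm (cos \<psi> *\<^sub>R x + sin \<psi> *\<^sub>R x') = norm x"
  proof -
    have "(sin \<psi>)\<^sup>2 * ((norm x)\<^sup>2 - (norm x')\<^sup>2) = 0" using 1 that 3 by algebra
    then show ?thesis using 2 by simp
  qed
  show "cos \<psi> = 0" if "norm (cos \<psi> *\<^sub>R x + sin \<psi> *\<^sub>R x') = norm x'"
  proof -
    have "(cos \<psi>)\<^sup>2 * ((norm x)\<^sup>2 - (norm x')\<^sup>2) = 0" using 1 that 3 by algebra
    then show ?thesis using 2 by simp
  qed
qed

text \<open>
  Dilations do not commute with rotations in general. But comparing norms of first components
  shows that an element of \<open>Kgrp\<close> can only induce \<open>\<plusminus>1\<close> on the plane, and an element of the
  other coset only a quarter turn. The first is a scalar. In the second case the four equations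
  saying that \<open>h\<close> acts as a quarter turn each relate components with the same
  scaling factor, so they survive the dilation.
\<close>
lemma stabilizer_commutes_dil:
  assumes h: "h \<in> Ggrp" and o: "x \<bullet> x' = 0" and n: "norm x \<noteq> norm x'" "norm y = norm x'" "norm y' = norm x"
    and eq: "act h ((x, y), (x', y')) = rot \<psi> ((x, y), (x', y'))"
  shows "act h (dil \<alpha> \<beta> ((x, y), (x', y'))) = rot \<psi> (dil \<alpha> \<beta> ((x, y), (x', y')))"
  using Ggrp_cases[OF h]
proof
  assume K: "h \<in> Kgrp"
  then obtain c a b where hk: "h = kmap c a b" "norm c = 1" "norm a = 1" by (auto simp: Kgrp_def)
  have "cos \<psi> *\<^sub>R x + sin \<psi> *\<^sub>R x' = c \<odot> (x \<odot> a)" using eq by (simp add: hk act_def rot_def kmap_def)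
  then have "norm (cos \<psi> *\<^sub>R x + sin \<psi> *\<^sub>R x') = norm x" using hk by (simp add: norm_qmult)
  then have "sin \<psi> = 0" using rot_norm_rigid[OF o n(1)] by blast
  then show ?thesis using eq by (simp add: rot_scalar act_kmap_dil[OF K] dil_scale del: scaleR_Pair)
next
  assume "prod.swap \<circ> h \<in> Kgrp"
  then obtain c a b where hk: "prod.swap \<circ> h = kmap c a b" "norm c = 1" "norm a = 1" "norm b = 1" by (auto simp: Kgrp_def)
  have hv: "h (x, y) = (c \<odot> (y \<odot> b), c \<odot> (x \<odot> a))" for x y
  proof -
    have "prod.swap (h (x, y)) = (c \<odot> (x \<odot> a), c \<odot> (y \<odot> b))"
      using fun_cong[OF hk(1), of "(x, y)"] by (simp add: kmap_def)
    then show ?thesis by (metis swap_simp swap_swap)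
  qed
  have e: "c \<odot> (y \<odot> b) = cos \<psi> *\<^sub>R x + sin \<psi> *\<^sub>R x'" "c \<odot> (x \<odot> a) = cos \<psi> *\<^sub>R y + sin \<psi> *\<^sub>R y'"
    "c \<odot> (y' \<odot> b) = (- sin \<psi>) *\<^sub>R x + cos \<psi> *\<^sub>R x'" "c \<odot> (x' \<odot> a) = (- sin \<psi>) *\<^sub>R y + cos \<psi> *\<^sub>R y'"
    using eq by (simp_all add: act_def rot_def hv)
  have "norm (cos \<psi> *\<^sub>R x + sin \<psi> *\<^sub>R x') = norm x'" using hk n by (simp add: norm_qmult flip: e(1))
  then have "cos \<psi> = 0" using rot_norm_rigid[OF o n(1)] by blast
  then show ?thesis using e by (simp add: act_def dil_def rot_def hv qmult.scaleR_left qmult.scaleR_right mult.commute)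
qed

lemma Stab_iff:
  assumes p: "p \<in> Vcone"
  shows "h \<in> Stab (oplane p) \<longleftrightarrow> h \<in> Ggrp \<and> (\<exists>\<psi>. act h p = rot \<psi> p)"
proof (cases "h \<in> Ggrp")
  case True
  then have lin: "linear h" by (rule Ggrp_linear)
  obtain r v where r: "r > 0" "v \<in> Vpairs" "p = r *\<^sub>R v" using Vcone_normalize[OF p] by metis
  have hn: "norm (h q) = norm q" for q using True orthogonal_transformation_norm by (auto simp: Ggrp_iff)
  have hv: "act h v \<in> Vpairs"
    using r(2) True hn by (cases v rule: prod.exhaust) (auto simp: Vpairs_def act_def Ggrp_iff)
  have "h \<in> Stab (oplane p) \<longleftrightarrow> oplane (act h p) = oplane p"
    using True lin by (simp add: Stab_def act_plane_oplane)
  also have "\<dots> \<longleftrightarrow> oplane v = oplane (act h v)"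
    using r lin by (auto simp: act_scale oplane_scale)
  also have "\<dots> \<longleftrightarrow> (\<exists>\<psi>. act h v = rot \<psi> v)" by (rule oplane_eq_iff_rot[OF r(2) hv])
  also have "\<dots> \<longleftrightarrow> (\<exists>\<psi>. act h p = rot \<psi> p)"
    using r(1) lin by (simp add: r(3) act_scale rot_scale)
  finally show ?thesis using True by simp
qed (simp add: Stab_def)

section \<open>The dilations and symmetries that reach a given pair\<close>

lemma rot_transfer:
  assumes "rot \<theta>' p = rot \<theta> q"
  shows "p = rot (\<theta> - \<theta>') q"
proof -
  have "p = rot (- \<theta>') (rot \<theta> q)" by (simp only: rot_inverse flip: assms)
  then show ?thesis by (simp add: rot_rot)
qed

lemma reached_norms:
  assumes g: "g \<in> Kgrp" and p0: "((x\<^sub>0, y\<^sub>0), (x\<^sub>0', y\<^sub>0')) \<in> Vcone" "x\<^sub>0 \<bullet> x\<^sub>0' = 0"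
    and p: "((x, y), (x', y')) \<in> Vcone"
    and ab: "\<alpha> > 0" "\<beta> > 0"
    and eq: "rot \<theta> (act g (dil \<alpha> \<beta> ((x\<^sub>0, y\<^sub>0), (x\<^sub>0', y\<^sub>0')))) = ((x, y), (x', y'))"
  obtains X Y X' Y' where "act g (dil \<alpha> \<beta> ((x\<^sub>0, y\<^sub>0), (x\<^sub>0', y\<^sub>0'))) = ((X, Y), (X', Y'))" "X \<bullet> X' = 0"
    "norm X = \<alpha> * norm x\<^sub>0" "norm X' = \<beta> * norm x\<^sub>0'" "\<alpha> * norm x\<^sub>0 \<noteq> \<beta> * norm x\<^sub>0'"
    "(\<alpha> * norm x\<^sub>0) * (\<beta> * norm x\<^sub>0') = norm (qIm (x \<odot> qcnj x'))"
    "(\<alpha> * norm x\<^sub>0)\<^sup>2 + (\<beta> * norm x\<^sub>0')\<^sup>2 = (norm (x, y))\<^sup>2"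
proof -
  obtain c a b where gk: "g = kmap c a b" and n: "norm c = 1" "norm a = 1" "norm b = 1"
    using g by (auto simp: Kgrp_def)
  obtain X Y X' Y' where act: "act g (dil \<alpha> \<beta> ((x\<^sub>0, y\<^sub>0), (x\<^sub>0', y\<^sub>0'))) = ((X, Y), (X', Y'))"
    by (metis prod.collapse)
  then have r: "rot (- \<theta>) ((x, y), (x', y')) = ((X, Y), (X', Y'))" using eq by (metis rot_inverse(1))
  have X: "X = c \<odot> ((\<alpha> *\<^sub>R x\<^sub>0) \<odot> a)" "X' = c \<odot> ((\<beta> *\<^sub>R x\<^sub>0') \<odot> a)"
    using act by (simp_all add: gk act_def dil_def kmap_def)
  have nX: "norm X = \<alpha> * norm x\<^sub>0" "norm X' = \<beta> * norm x\<^sub>0'"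
    using n ab by (simp_all add: X norm_qmult)
  have "X \<bullet> X' = (\<alpha> *\<^sub>R x\<^sub>0) \<bullet> (\<beta> *\<^sub>R x\<^sub>0')"
  proof -
    have "kmap c a b u \<bullet> kmap c a b v = u \<bullet> v" for u v
      using kmap_orthogonal[OF n] by (simp add: orthogonal_transformation_def)
    from this[of "(\<alpha> *\<^sub>R x\<^sub>0, 0)" "(\<beta> *\<^sub>R x\<^sub>0', 0)"] show ?thesis by (simp add: X kmap_def)
  qed
  then have o: "X \<bullet> X' = 0" using p0(2) by simp
  have W: "((X, Y), (X', Y')) \<in> Vcone" using Vcone_rot[OF p, of "- \<theta>"] r by simp
  have "norm (x, y) = norm (x', y')" "Bform (x, y) (x', y') = 0" using p unfolding Vcone_iff by blast+
  note inv = rot_invariants[OF this r]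
  note N = Vcone_orthogonal_norms[OF W o]
  show ?thesis using that[OF act o nX] N nX inv by metis
qed

text \<open>
  The dilation adjusts the norms of the first components; those of the second components follow
  from \<open>isotropic_pair_norms\<close>, and \<open>kmap_transitive\<close> does the rest.
\<close>
lemma dil_reaches:
  assumes p0: "((x\<^sub>0, y\<^sub>0), (x\<^sub>0', y\<^sub>0')) \<in> Vcone" "x\<^sub>0 \<bullet> x\<^sub>0' = 0"
    and p: "p \<in> Vcone" and r: "rot \<theta> p = ((X, Y), (X', Y'))" and o: "X \<bullet> X' = 0"
  obtains g where "g \<in> Kgrp"
    "rot (- \<theta>) (act g (dil (norm X / norm x\<^sub>0) (norm X' / norm x\<^sub>0') ((x\<^sub>0, y\<^sub>0), (x\<^sub>0', y\<^sub>0')))) = p"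
proof -
  define \<alpha> \<beta> where "\<alpha> = norm X / norm x\<^sub>0" "\<beta> = norm X' / norm x\<^sub>0'" note ab = this
  have W: "((X, Y), (X', Y')) \<in> Vcone" using Vcone_rot[OF p, of \<theta>] r by simp
  note N = Vcone_orthogonal_norms[OF W o] and N0 = Vcone_orthogonal_norms[OF p0]
  have "Bform (x\<^sub>0, y\<^sub>0) (x\<^sub>0', y\<^sub>0') = 0" "Bform (X, Y) (X', Y') = 0" using p0(1) W unfolding Vcone_iff by blast+
  moreover have "Bform (\<alpha> *\<^sub>R x\<^sub>0, \<beta> *\<^sub>R y\<^sub>0) (\<beta> *\<^sub>R x\<^sub>0', \<alpha> *\<^sub>R y\<^sub>0') = (\<alpha> * \<beta>) *\<^sub>R Bform (x\<^sub>0, y\<^sub>0) (x\<^sub>0', y\<^sub>0')"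
    by (simp add: Bform_def qcnj_simps qmult.scaleR_left qmult.scaleR_right scaleR_add_right mult.commute)
  ultimately have B: "Bform (\<alpha> *\<^sub>R x\<^sub>0, \<beta> *\<^sub>R y\<^sub>0) (\<beta> *\<^sub>R x\<^sub>0', \<alpha> *\<^sub>R y\<^sub>0') = 0" "Bform (X, Y) (X', Y') = 0" by simp_all
  have y0: "y\<^sub>0 \<noteq> 0" using N0 by auto
  have "\<alpha> \<noteq> 0" "\<beta> \<noteq> 0" using N N0 by (simp_all add: ab)
  then have nz: "\<alpha> *\<^sub>R x\<^sub>0 \<noteq> 0" "\<beta> *\<^sub>R x\<^sub>0' \<noteq> 0" "\<beta> *\<^sub>R y\<^sub>0 \<noteq> 0" using N0 y0 by simp_all
  have n: "norm X = norm (\<alpha> *\<^sub>R x\<^sub>0)" "norm X' = norm (\<beta> *\<^sub>R x\<^sub>0')" "norm Y = norm (\<beta> *\<^sub>R y\<^sub>0)"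
    using N N0 by (simp_all add: ab)
  have "(\<alpha> *\<^sub>R x\<^sub>0) \<bullet> (\<beta> *\<^sub>R x\<^sub>0') = 0" using p0(2) by simp
  from kmap_transitive[OF B this o n nz] obtain g where "g \<in> Kgrp"
     "act g ((\<alpha> *\<^sub>R x\<^sub>0, \<beta> *\<^sub>R y\<^sub>0), (\<beta> *\<^sub>R x\<^sub>0', \<alpha> *\<^sub>R y\<^sub>0')) = ((X, Y), (X', Y'))"
    by metis
  then show ?thesis using that[of g] r rot_inverse(1)[of \<theta> p] by (simp add: dil_def flip: ab)
qed

text \<open>
  Both \<open>a\<^sup>2\<close> and \<open>b\<^sup>2\<close> are roots of the quadratic polynomial with roots \<open>s\<^sup>2\<close> and \<open>t\<^sup>2\<close>.
\<close>
lemma same_sum_product: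
  fixes a b s t :: real
  assumes "a * b = s * t" "a\<^sup>2 + b\<^sup>2 = s\<^sup>2 + t\<^sup>2" "a > 0" "b > 0" "s > 0" "t > 0"
  shows "(a = s \<and> b = t) \<or> (a = t \<and> b = s)"
proof -
  have "(a - s) * (a + s) * ((a - t) * (a + t)) = 0" using assms(1,2) by algebra
  then have "a = s \<or> a = t" using assms by auto
  then show ?thesis using assms by auto
qed

text \<open>
  The numbers \<open>\<alpha> \<bar>x\<^sub>0\<bar>\<close> and \<open>\<beta> \<bar>x\<^sub>0'\<bar>\<close> are the norms of the orthogonal first components of a
  rotated copy of the given pair. Their product \<open>\<bar>Im (x (qcnj x'))\<bar>\<close> and the sum \<open>\<bar>q\<bar>\<^sup>2\<close> of their
  squares are invariants, so they are \<open>s, t\<close> or \<open>t, s\<close> with \<open>s < t\<close>; both orders occur because a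
  quarter turn exchanges them. The bound comes from \<open>2 s\<^sup>2 < s\<^sup>2 + t\<^sup>2 = \<bar>q\<bar>\<^sup>2 < 2 t\<^sup>2\<close>.
\<close>
lemma reachable_dilations:
  assumes p0: "((x\<^sub>0, y\<^sub>0), (x\<^sub>0', y\<^sub>0')) \<in> Vcone" "x\<^sub>0 \<bullet> x\<^sub>0' = 0"
    and p: "((x, y), (x', y')) \<in> Vcone"
  obtains \<alpha>\<^sub>1 \<beta>\<^sub>1 \<alpha>\<^sub>2 \<beta>\<^sub>2 where
    "\<alpha>\<^sub>1 < norm (x, y) / (sqrt 2 * norm x\<^sub>0)" "norm (x, y) / (sqrt 2 * norm x\<^sub>0) < \<alpha>\<^sub>2"
    "{(\<alpha>, \<beta>). \<alpha> > 0 \<and> \<beta> > 0 \<and>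
       (\<exists>g \<in> Kgrp. \<exists>\<theta>. rot \<theta> (act g (dil \<alpha> \<beta> ((x\<^sub>0, y\<^sub>0), (x\<^sub>0', y\<^sub>0')))) = ((x, y), (x', y')))}
     = {(\<alpha>\<^sub>1, \<beta>\<^sub>1), (\<alpha>\<^sub>2, \<beta>\<^sub>2)}"
proof -
  let ?start = "((x\<^sub>0, y\<^sub>0), (x\<^sub>0', y\<^sub>0'))" and ?target = "((x, y), (x', y'))"
  let ?S = "{(\<alpha>, \<beta>). \<alpha> > 0 \<and> \<beta> > 0 \<and> (\<exists>g \<in> Kgrp. \<exists>\<theta>. rot \<theta> (act g (dil \<alpha> \<beta> ?start)) = ?target)}"
  obtain \<theta> X Y X' Y' where r: "rot \<theta> ?target = ((X, Y), (X', Y'))" and o: "X \<bullet> X' = 0" and lt: "norm X < norm X'"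
    using orth_rot_normal_form[OF p] by metis
  have r2: "rot (pi / 2 + \<theta>) ?target = ((X', Y'), (- X, - Y))"
    by (simp flip: rot_rot add: r) (simp add: rot_def)
  define s t where "s = norm X" "t = norm X'" note st = this
  define r\<^sub>0 r\<^sub>0' where "r\<^sub>0 = norm x\<^sub>0" "r\<^sub>0' = norm x\<^sub>0'" note r0 = this
  have W: "((X, Y), (X', Y')) \<in> Vcone" using Vcone_rot[OF p, of \<theta>] r by simp
  note N = Vcone_orthogonal_norms[OF W o] and N0 = Vcone_orthogonal_norms[OF p0]
  have "norm (x, y) = norm (x', y')" "Bform (x, y) (x', y') = 0" using p unfolding Vcone_iff by blast+
  note inv = rot_invariants[OF this r]
  have pos: "s > 0" "t > 0" "r\<^sub>0 > 0" "r\<^sub>0' > 0" and less: "s < t" using N N0 lt by (simp_all add: st r0)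
  have sq: "s\<^sup>2 + t\<^sup>2 = (norm (x, y))\<^sup>2" using N(5) inv by (simp add: st)
  have pr: "s * t = norm (qIm (x \<odot> qcnj x'))" using N(4) inv by (simp add: st)
  have "s\<^sup>2 < t\<^sup>2" using less pos by (simp add: power_strict_mono)
  then have "(sqrt 2 * s)\<^sup>2 < (norm (x, y))\<^sup>2" "(norm (x, y))\<^sup>2 < (sqrt 2 * t)\<^sup>2"
    using sq by (simp_all add: power_mult_distrib)
  then have "sqrt 2 * s < norm (x, y)" "norm (x, y) < sqrt 2 * t"
    using pos by (metis norm_ge_zero power2_less_imp_less, metis power2_less_imp_less mult_nonneg_nonneg less_imp_le real_sqrt_ge_zero zero_le_numeral)
  then have bounds: "s / r\<^sub>0 < norm (x, y) / (sqrt 2 * norm x\<^sub>0)" "norm (x, y) / (sqrt 2 * norm x\<^sub>0) < t / r\<^sub>0"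
    using pos by (simp_all add: field_simps flip: r0)
  have "?S = {(s / r\<^sub>0, t / r\<^sub>0'), (t / r\<^sub>0, s / r\<^sub>0')}"
  proof (intro equalityI subsetI)
    fix z assume "z \<in> ?S"
    then obtain \<alpha> \<beta> g \<psi> where z: "z = (\<alpha>, \<beta>)" "\<alpha> > 0" "\<beta> > 0" and g: "g \<in> Kgrp" "rot \<psi> (act g (dil \<alpha> \<beta> ?start)) = ?target"
      by blast
    have "(\<alpha> * r\<^sub>0) * (\<beta> * r\<^sub>0') = s * t" "(\<alpha> * r\<^sub>0)\<^sup>2 + (\<beta> * r\<^sub>0')\<^sup>2 = s\<^sup>2 + t\<^sup>2"
      unfolding sq pr r0 using reached_norms[OF g(1) p0 p z(2,3) g(2)] by metis+
    moreover have "\<alpha> * r\<^sub>0 > 0" "\<beta> * r\<^sub>0' > 0" using z pos by simp_all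
    ultimately have "(\<alpha> * r\<^sub>0 = s \<and> \<beta> * r\<^sub>0' = t) \<or> (\<alpha> * r\<^sub>0 = t \<and> \<beta> * r\<^sub>0' = s)"
      using same_sum_product pos by blast
    then show "z \<in> {(s / r\<^sub>0, t / r\<^sub>0'), (t / r\<^sub>0, s / r\<^sub>0')}" using pos z by (auto simp: field_simps)
  next
    fix z assume z: "z \<in> {(s / r\<^sub>0, t / r\<^sub>0'), (t / r\<^sub>0, s / r\<^sub>0')}"
    obtain g where "g \<in> Kgrp" "rot (- \<theta>) (act g (dil (s / r\<^sub>0) (t / r\<^sub>0') ?start)) = ?target"
      using dil_reaches[OF p0 p r o] by (metis st r0)
    moreover have "X' \<bullet> - X = 0" using o by (simp add: inner_commute)
    from dil_reaches[OF p0 p r2 this]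
    obtain g' where "g' \<in> Kgrp" "rot (- (pi / 2 + \<theta>)) (act g' (dil (t / r\<^sub>0) (s / r\<^sub>0') ?start)) = ?target"
      by (metis st r0 norm_minus_cancel)
    ultimately show "z \<in> ?S" using z pos by fastforce
  qed
  then show ?thesis using that bounds by metis
qed

lemma rot_eq_or_minus:
  assumes "sin (\<theta> - \<theta>') = 0"
  shows "rot \<theta>' = rot \<theta> \<or> rot \<theta>' = (\<lambda>p. - rot \<theta> p)"
proof -
  have s: "sin (\<theta>' - \<theta>) = 0" using assms by (metis minus_diff_eq sin_minus neg_equal_0_iff_equal)
  have *: "rot \<theta>' p = cos (\<theta>' - \<theta>) *\<^sub>R rot \<theta> p" for p
    using rot_scalar[OF s, of "rot \<theta> p"] by (simp add: rot_rot)
  have "(cos (\<theta>' - \<theta>))\<^sup>2 = 1" using sin_cos_squared_add[of "\<theta>' - \<theta>"] s by simp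
  then have "cos (\<theta>' - \<theta>) = 1 \<or> cos (\<theta>' - \<theta>) = -1" by (simp add: power2_eq_1_iff)
  then show ?thesis using * by (auto simp: fun_eq_iff)
qed

lemma Kgrp_minus:
  assumes "g \<in> Kgrp" shows "(\<lambda>v. - g v) \<in> Kgrp"
proof -
  obtain c a b where g: "g = kmap c a b" "norm c = 1" "norm a = 1" "norm b = 1"
    using assms by (auto simp: Kgrp_def)
  have "(\<lambda>v. - g v) = kmap (- c) a b" by (auto simp: g kmap_def qmult.minus_left)
  then show ?thesis using g kmap_in_Kgrp[of "- c" a b] by simp
qed

lemma act_minus: "act (\<lambda>v. - g v) p = - act g p"
  by (simp add: act_def split_beta)

text \<open>
  Two solutions for the same dilated pair \<open>P\<close> differ by a rotation of \<open>act g P\<close>. If both group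
  elements lie in \<open>Kgrp\<close>, norms of first components show that this rotation is \<open>\<plusminus>1\<close>. In
  \<open>Ggrp\<close> the two elements differ by a stabilizer of the plane of \<open>P\<close>, and
  by \<open>stabilizer_commutes_dil\<close>, applied to a dilation and to its inverse, this stabilizer is
  that of the plane of the undilated pair.
\<close>
lemma solutions_of_fixed_dilation:
  assumes p0: "((x\<^sub>0, y\<^sub>0), (x\<^sub>0', y\<^sub>0')) \<in> Vcone" "x\<^sub>0 \<bullet> x\<^sub>0' = 0"
    and p: "((x, y), (x', y')) \<in> Vcone"
    and ab: "\<alpha> > 0" "\<beta> > 0" and g: "g \<in> Kgrp"
    and P: "P = dil \<alpha> \<beta> ((x\<^sub>0, y\<^sub>0), (x\<^sub>0', y\<^sub>0'))"
    and eq: "rot \<theta> (act g P) = ((x, y), (x', y'))"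
  shows "(\<exists>g' \<in> Kgrp. rot \<theta>' (act g' P) = ((x, y), (x', y')))
      \<longleftrightarrow> rot \<theta>' = rot \<theta> \<or> rot \<theta>' = (\<lambda>p. - rot \<theta> p)" (is "?L \<longleftrightarrow> ?R")
    and "{g' \<in> Ggrp. \<exists>\<theta>'. rot \<theta>' (act g' P) = ((x, y), (x', y'))}
      = {g \<circ> h | h. h \<in> Stab (oplane ((x\<^sub>0, y\<^sub>0), (x\<^sub>0', y\<^sub>0')))}" (is "?A = ?B")
proof -
  let ?start = "((x\<^sub>0, y\<^sub>0), (x\<^sub>0', y\<^sub>0'))" and ?target = "((x, y), (x', y'))"
  obtain X Y X' Y' where X: "act g P = ((X, Y), (X', Y'))" "X \<bullet> X' = 0"
    "norm X = \<alpha> * norm x\<^sub>0" "norm X' = \<beta> * norm x\<^sub>0'" "\<alpha> * norm x\<^sub>0 \<noteq> \<beta> * norm x\<^sub>0'"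
    using reached_norms[OF g p0 p ab eq[unfolded P]] P by metis
  have opposite: "rot \<theta>' z = ?target" if "rot \<theta>' = (\<lambda>p. - rot \<theta> p)" "z = - act g P" for z
    using that eq by (simp add: rot_minus)
  show "?L \<longleftrightarrow> ?R"
  proof
    assume ?L
    then obtain g' where g': "g' \<in> Kgrp" "rot \<theta>' (act g' P) = ?target" by blast
    obtain Z U Z' U' where Z: "act g' P = ((Z, U), (Z', U'))" "norm Z = \<alpha> * norm x\<^sub>0"
      using reached_norms[OF g'(1) p0 p ab g'(2)[unfolded P]] P by metis
    have "act g' P = rot (\<theta> - \<theta>') (act g P)"
      by (rule rot_transfer) (simp only: g'(2) eq)
    then have "Z = cos (\<theta> - \<theta>') *\<^sub>R X + sin (\<theta> - \<theta>') *\<^sub>R X'"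
      by (simp add: Z(1) X(1) rot_def)
    then have "sin (\<theta> - \<theta>') = 0" using rot_norm_rigid(1)[of X X' "\<theta> - \<theta>'"] X Z(2) by metis
    then show ?R by (rule rot_eq_or_minus)
  next
    assume ?R
    then show ?L
    proof
      assume "rot \<theta>' = rot \<theta>" then show ?L using g eq by metis
    next
      assume "rot \<theta>' = (\<lambda>p. - rot \<theta> p)"
      then have "rot \<theta>' (act (\<lambda>v. - g v) P) = ?target" by (rule opposite) (rule act_minus)
      then show ?L using Kgrp_minus[OF g] by blast
    qed
  qed
  have gG: "g \<in> Ggrp" using g Kgrp_subset_Ggrp by blast
  note N0 = Vcone_orthogonal_norms[OF p0]
  have PP: "P = ((\<alpha> *\<^sub>R x\<^sub>0, \<beta> *\<^sub>R y\<^sub>0), (\<beta> *\<^sub>R x\<^sub>0', \<alpha> *\<^sub>R y\<^sub>0'))" by (simp add: P dil_def)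
  have stab: "act h P = rot \<psi> P \<longleftrightarrow> act h ?start = rot \<psi> ?start" if h: "h \<in> Ggrp" for h \<psi>
  proof
    assume "act h ?start = rot \<psi> ?start"
    then show "act h P = rot \<psi> P" unfolding P using stabilizer_commutes_dil[OF h p0(2)] N0 by blast
  next
    assume "act h P = rot \<psi> P"
    then have "act h (dil (1 / \<alpha>) (1 / \<beta>) P) = rot \<psi> (dil (1 / \<alpha>) (1 / \<beta>) P)"
      unfolding PP using stabilizer_commutes_dil[OF h] p0(2) X(5) N0 ab by simp
    then show "act h ?start = rot \<psi> ?start" using ab by (simp add: P dil_dil dil_one)
  qed
  have Stab: "h \<in> Stab (oplane ?start) \<longleftrightarrow> h \<in> Ggrp \<and> (\<exists>\<psi>. act h P = rot \<psi> P)" for h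
    using Stab_iff[OF p0(1)] stab by blast
  show "?A = ?B"
  proof (intro equalityI subsetI)
    fix g' assume "g' \<in> ?A"
    then obtain \<theta>' where g': "g' \<in> Ggrp" "rot \<theta>' (act g' P) = ?target" by blast
    obtain k where k: "k \<in> Ggrp" "k \<circ> g = id" "g \<circ> k = id" using Ggrp_inv[OF gG] by metis
    have "act g' P = rot (\<theta> - \<theta>') (act g P)"
      by (rule rot_transfer) (simp only: g'(2) eq)
    then have "act (k \<circ> g') P = rot (\<theta> - \<theta>') (act (k \<circ> g) P)"
      using act_rot[OF Ggrp_linear[OF k(1)]] by (simp add: act_comp)
    also have "act (k \<circ> g) P = P" unfolding k(2) by (simp add: act_def split_beta)
    finally have "k \<circ> g' \<in> Stab (oplane ?start)" using Stab Ggrp_compose[OF k(1) g'(1)] by blast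
    moreover have "g' = g \<circ> (k \<circ> g')" using k(3) by (simp flip: comp_assoc)
    ultimately show "g' \<in> ?B" by blast
  next
    fix g' assume "g' \<in> ?B"
    then obtain h \<psi> where h: "g' = g \<circ> h" "h \<in> Ggrp" "act h P = rot \<psi> P" using Stab by blast
    have "rot (\<theta> - \<psi>) (act g' P) = rot \<theta> (act g P)"
      using act_rot[OF Ggrp_linear[OF gG], of \<psi> P] by (simp add: h act_comp rot_rot)
    then show "g' \<in> ?A" using eq Ggrp_compose[OF gG h(2)] h(1) by auto
  qed
qed

theorem mainTheorem5:
  shows
    "V1 = {((x, y), (x', y')) | x y x' y'.
        (x, y) \<noteq> 0 \<and> (x', y') \<noteq> 0 \<and>
        norm (x, y) = norm (x', y') \<and> Bform (x, y) (x', y') = 0 \<and>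
        0 < norm (qIm (x \<odot> qcnj x')) \<and>
        norm (qIm (x \<odot> qcnj x')) < 1 / 2 * (norm (x, y))\<^sup>2}
    \<and> (\<forall>g \<in> G0grp. \<forall>\<alpha>>0. \<forall>\<beta>>0. \<forall>p \<in> V1. act g (dil \<alpha> \<beta> p) = dil \<alpha> \<beta> (act g p))
    \<and> (\<forall>x\<^sub>0 y\<^sub>0 x\<^sub>0' y\<^sub>0' q\<^sub>0 q\<^sub>0'.
        q\<^sub>0 = (x\<^sub>0, y\<^sub>0) \<and> q\<^sub>0' = (x\<^sub>0', y\<^sub>0') \<and> (q\<^sub>0, q\<^sub>0') \<in> V1 \<and> x\<^sub>0 \<bullet> x\<^sub>0' = 0 \<longrightarrow>
        (\<forall>q q'. (q, q') \<in> V1 \<longrightarrow>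
          (\<exists>g \<in> G0grp. \<exists>\<alpha>>0. \<exists>\<beta>>0. \<exists>\<theta>. rot \<theta> (act g (dil \<alpha> \<beta> (q\<^sub>0, q\<^sub>0'))) = (q, q'))
          \<and> (\<exists>\<alpha>\<^sub>1 \<beta>\<^sub>1 \<alpha>\<^sub>2 \<beta>\<^sub>2.
              \<alpha>\<^sub>1 < norm q / (sqrt 2 * norm x\<^sub>0) \<and> norm q / (sqrt 2 * norm x\<^sub>0) < \<alpha>\<^sub>2 \<and>
              {(\<alpha>, \<beta>). \<alpha> > 0 \<and> \<beta> > 0 \<and>
                 (\<exists>g \<in> G0grp. \<exists>\<theta>. rot \<theta> (act g (dil \<alpha> \<beta> (q\<^sub>0, q\<^sub>0'))) = (q, q'))}
              = {(\<alpha>\<^sub>1, \<beta>\<^sub>1), (\<alpha>\<^sub>2, \<beta>\<^sub>2)})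
          \<and> (\<forall>g \<in> G0grp. \<forall>\<alpha>>0. \<forall>\<beta>>0. \<forall>\<theta>.
              rot \<theta> (act g (dil \<alpha> \<beta> (q\<^sub>0, q\<^sub>0'))) = (q, q') \<longrightarrow>
              (\<forall>\<theta>'. (\<exists>g' \<in> G0grp. rot \<theta>' (act g' (dil \<alpha> \<beta> (q\<^sub>0, q\<^sub>0'))) = (q, q'))
                    \<longleftrightarrow> rot \<theta>' = rot \<theta> \<or> rot \<theta>' = (\<lambda>p. - rot \<theta> p))
              \<and> (\<lambda>v. - g v) \<in> G0grp
              \<and> (\<forall>\<theta>'. rot \<theta>' = (\<lambda>p. - rot \<theta> p) \<longrightarrow>
                    rot \<theta>' (act (\<lambda>v. - g v) (dil \<alpha> \<beta> (q\<^sub>0, q\<^sub>0'))) = (q, q'))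
              \<and> {g' \<in> Ggrp. \<exists>\<theta>'. rot \<theta>' (act g' (dil \<alpha> \<beta> (q\<^sub>0, q\<^sub>0'))) = (q, q')}
                = {g \<circ> h | h. h \<in> Stab (oplane (q\<^sub>0, q\<^sub>0'))})))"
  (is "?dom \<and> ?comm \<and> ?orbits")
proof (intro conjI)
  show ?dom unfolding V1_eq_Vcone Vcone_def ..
  show ?comm unfolding G0grp_eq_Kgrp using act_kmap_dil by blast
  show ?orbits unfolding V1_eq_Vcone G0grp_eq_Kgrp
  proof (intro allI impI, elim conjE, hypsubst, intro conjI)
    fix x\<^sub>0 y\<^sub>0 x\<^sub>0' y\<^sub>0' :: quat and q q' :: oct
    let ?start = "((x\<^sub>0, y\<^sub>0), (x\<^sub>0', y\<^sub>0'))"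
    assume p0: "?start \<in> Vcone" "x\<^sub>0 \<bullet> x\<^sub>0' = 0" and "(q, q') \<in> Vcone"
    moreover obtain x y x' y' where q: "q = (x, y)" "q' = (x', y')" by (metis prod.collapse)
    ultimately have p: "((x, y), (x', y')) \<in> Vcone" by simp
    obtain \<alpha>\<^sub>1 \<beta>\<^sub>1 \<alpha>\<^sub>2 \<beta>\<^sub>2 where ab:
      "\<alpha>\<^sub>1 < norm q / (sqrt 2 * norm x\<^sub>0)" "norm q / (sqrt 2 * norm x\<^sub>0) < \<alpha>\<^sub>2"
      "{(\<alpha>, \<beta>). \<alpha> > 0 \<and> \<beta> > 0 \<and> (\<exists>g \<in> Kgrp. \<exists>\<theta>. rot \<theta> (act g (dil \<alpha> \<beta> ?start)) = (q, q'))}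
        = {(\<alpha>\<^sub>1, \<beta>\<^sub>1), (\<alpha>\<^sub>2, \<beta>\<^sub>2)}"
      by (rule reachable_dilations[OF p0 p, folded q])
    then show "\<exists>\<alpha>\<^sub>1 \<beta>\<^sub>1 \<alpha>\<^sub>2 \<beta>\<^sub>2.
              \<alpha>\<^sub>1 < norm q / (sqrt 2 * norm x\<^sub>0) \<and> norm q / (sqrt 2 * norm x\<^sub>0) < \<alpha>\<^sub>2 \<and>
              {(\<alpha>, \<beta>). \<alpha> > 0 \<and> \<beta> > 0 \<and>
                 (\<exists>g \<in> Kgrp. \<exists>\<theta>. rot \<theta> (act g (dil \<alpha> \<beta> ?start)) = (q, q'))}
              = {(\<alpha>\<^sub>1, \<beta>\<^sub>1), (\<alpha>\<^sub>2, \<beta>\<^sub>2)}" by blast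
    show "\<exists>g \<in> Kgrp. \<exists>\<alpha>>0. \<exists>\<beta>>0. \<exists>\<theta>. rot \<theta> (act g (dil \<alpha> \<beta> ?start)) = (q, q')"
    proof -
      have "(\<alpha>\<^sub>1, \<beta>\<^sub>1) \<in> {(\<alpha>, \<beta>). \<alpha> > 0 \<and> \<beta> > 0 \<and>
          (\<exists>g \<in> Kgrp. \<exists>\<theta>. rot \<theta> (act g (dil \<alpha> \<beta> ?start)) = (q, q'))}"
        unfolding ab(3) by simp
      then show ?thesis by blast
    qed
    show "\<forall>g \<in> Kgrp. \<forall>\<alpha>>0. \<forall>\<beta>>0. \<forall>\<theta>.
              rot \<theta> (act g (dil \<alpha> \<beta> ?start)) = (q, q') \<longrightarrow>
              (\<forall>\<theta>'. (\<exists>g' \<in> Kgrp. rot \<theta>' (act g' (dil \<alpha> \<beta> ?start)) = (q, q'))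
                    \<longleftrightarrow> rot \<theta>' = rot \<theta> \<or> rot \<theta>' = (\<lambda>p. - rot \<theta> p))
              \<and> (\<lambda>v. - g v) \<in> Kgrp
              \<and> (\<forall>\<theta>'. rot \<theta>' = (\<lambda>p. - rot \<theta> p) \<longrightarrow>
                    rot \<theta>' (act (\<lambda>v. - g v) (dil \<alpha> \<beta> ?start)) = (q, q'))
              \<and> {g' \<in> Ggrp. \<exists>\<theta>'. rot \<theta>' (act g' (dil \<alpha> \<beta> ?start)) = (q, q')}
                = {g \<circ> h | h. h \<in> Stab (oplane ?start)}"
    proof (intro ballI allI impI conjI)
      fix g \<alpha> \<beta> \<theta>
      assume g: "g \<in> Kgrp" "0 < \<alpha>" "0 < \<beta>" and eq: "rot \<theta> (act g (dil \<alpha> \<beta> ?start)) = (q, q')"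
      note sol = solutions_of_fixed_dilation[OF p0 p g(2,3,1) refl eq[unfolded q], folded q]
      show "(\<exists>g' \<in> Kgrp. rot \<theta>' (act g' (dil \<alpha> \<beta> ?start)) = (q, q'))
         \<longleftrightarrow> rot \<theta>' = rot \<theta> \<or> rot \<theta>' = (\<lambda>p. - rot \<theta> p)" for \<theta>' by (rule sol)
      show "(\<lambda>v. - g v) \<in> Kgrp" by (rule Kgrp_minus[OF g(1)])
      show "rot \<theta>' (act (\<lambda>v. - g v) (dil \<alpha> \<beta> ?start)) = (q, q')" if "rot \<theta>' = (\<lambda>p. - rot \<theta> p)" for \<theta>'
        using that eq by (simp add: act_minus rot_minus)
      show "{g' \<in> Ggrp. \<exists>\<theta>'. rot \<theta>' (act g' (dil \<alpha> \<beta> ?start)) = (q, q')}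
                = {g \<circ> h | h. h \<in> Stab (oplane ?start)}" by (rule sol)
    qed
  qed
qed

end
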